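(* Let $n,k \in \mathbb{N}$, let $G_k=(V,E)$ be a $k$-regular graph, and let $\mathbf{m} = (m_{ij}) \in \mathbb{N}_{0}^{n \times n}$ be such that $\sum_{j=1}^n m_{ij}=k$ holds for all $i = 1,2, \ldots, n$. Let $v \in \mathbb{R}^n$ be a solution of the equation $$0 = d(\mathbf{m} \cdot v - k v) + F(v).$$ If there exists an $\mathbf{m}$-perfect coloring $\Gamma$ of the graph $G_k$, then there exists an $\mathbf{m}$-perfect stationary solution $u: V \to \mathbb{R}$ of $$\dot{u}_i(t) = d \sum_{j \in N(i)}(u_j(t)-u_i(t))+f(u_i(t)), \quad i \in V,\ t>0, \qquad (\mathrm{GDE})$$ given by $v_{\Gamma(i)} = u_i$, $i \in V$. Moreover, the vector $v$ is an asymptotically stable stationary solution of the system $$\dot{v}(t) = d(\mathbf{m} \cdot v(t) - k v(t)) + F(v(t))$$ if and only if $u$ is an asymptotically stable stationary solution of (GDE) in the $\ell^\infty$-norm.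
   Context: Graphs are undirected and simple, with a finite or countably infinite vertex set $V$; $N(i)=\{j\in V : \{i,j\}\in E\}$; $G_k$ is $k$-regular if $|N(i)|=k$ for all $i\in V$. $\mathbb{N}_0=\{0,1,2,\dots\}$. In (GDE), $d>0$ is the diffusion parameter and $f:\mathbb{R}\to\mathbb{R}$ is a given continuous reaction function. For $v\in\mathbb{R}^n$, $F(v)=(f(v_1),\dots,f(v_n))$. A coloring of $G_k$ with color set $C=\{1,\dots,n\}$ is a map $\Gamma:V\to C$. For $\mathbf{m}\in\mathbb{N}_0^{n\times n}$ with all row sums equal to $k$, the coloring $\Gamma$ is $\mathbf{m}$-perfect if for every $i\in V$ and every color $c\in C$, the number of neighbors $j\in N(i)$ with $\Gamma(j)=c$ equals $m_{\Gamma(i)c}$. A stationary solution of (GDE) is a map $u:V\to\mathbb{R}$ with $0=d\sum_{j\in N(i)}(u_j-u_i)+f(u_i)$ for all $i\in V$; $\mathrm{Im}(u)$ is its set of values. A stationary solution $u$ is called an $\mathbf{m}$-perfect stationary solution if there exist an $\mathbf{m}$-perfect coloring $\Gamma$ of $G_k$ and a surjection $v:C\to\mathrm{Im}(u)$ such that $v_{\Gamma(i)}=u_i$ for every $i\in V$.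
   Formalization: The stability equivalence is stated only for colorings Γ that use all n colors; otherwise it fails: n=2, m=k·Id, Γ constantly 1, f(v1)=f(v2)=0, f'(v1)<0<f'(v2) makes u stable but v unstable. *)

theory Defs
  imports "HOL-Analysis.Analysis"
begin

definition simple_graph :: "'v set \<Rightarrow> 'v set set \<Rightarrow> bool" where
  "simple_graph V E \<longleftrightarrow> V \<noteq> {} \<and> countable V \<and> (\<forall>e\<in>E. e \<subseteq> V \<and> card e = 2)"

definition nbrs :: "'v set \<Rightarrow> 'v set set \<Rightarrow> 'v \<Rightarrow> 'v set" where
  "nbrs V E i = {j \<in> V. {i, j} \<in> E}"

definition regular_graph :: "nat \<Rightarrow> 'v set \<Rightarrow> 'v set set \<Rightarrow> bool" where
  "regular_graph k V E \<longleftrightarrow>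
     simple_graph V E \<and> (\<forall>i\<in>V. finite (nbrs V E i) \<and> card (nbrs V E i) = k)"

text \<open>The colour set is the finite type \<open>'n\<close>. Colourings need not use every colour.\<close>

definition perfect_coloring ::
    "'v set \<Rightarrow> 'v set set \<Rightarrow> nat ^ 'n ^ 'n \<Rightarrow> ('v \<Rightarrow> 'n) \<Rightarrow> bool" where
  "perfect_coloring V E m \<Gamma> \<longleftrightarrow>
     (\<forall>i\<in>V. \<forall>c. card {j \<in> nbrs V E i. \<Gamma> j = c} = m $ \<Gamma> i $ c)"

definition gde_rhs ::
    "'v set \<Rightarrow> 'v set set \<Rightarrow> real \<Rightarrow> (real \<Rightarrow> real) \<Rightarrow> ('v \<Rightarrow> real) \<Rightarrow> 'v \<Rightarrow> real" where
  "gde_rhs V E d f u i = d * (\<Sum>j\<in>nbrs V E i. u j - u i) + f (u i)"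

definition gde_stationary ::
    "'v set \<Rightarrow> 'v set set \<Rightarrow> real \<Rightarrow> (real \<Rightarrow> real) \<Rightarrow> ('v \<Rightarrow> real) \<Rightarrow> bool" where
  "gde_stationary V E d f u \<longleftrightarrow> (\<forall>i\<in>V. 0 = gde_rhs V E d f u i)"

definition perfect_stationary ::
    "'v set \<Rightarrow> 'v set set \<Rightarrow> real \<Rightarrow> (real \<Rightarrow> real) \<Rightarrow> nat ^ 'n ^ 'n \<Rightarrow> ('v \<Rightarrow> real) \<Rightarrow> bool" where
  "perfect_stationary V E d f m u \<longleftrightarrow>
     gde_stationary V E d f u \<and>
     (\<exists>\<Gamma> w. perfect_coloring V E m \<Gamma> \<and> range w = u ` V \<and> (\<forall>i\<in>V. w (\<Gamma> i) = u i))"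

text \<open>Below, \<open>J\<close> is a time interval \<open>{0..<T}\<close> or \<open>{0..}\<close>. A solution of (GDE) is a continuous curve
  in \<open>\<ell>\<^sup>\<infinity>(V)\<close>: each state is bounded on \<open>V\<close>, and uniform convergence on \<open>V\<close> is convergence in the
  \<open>\<ell>\<^sup>\<infinity>\<close>-norm.\<close>

definition gde_solution ::
    "'v set \<Rightarrow> 'v set set \<Rightarrow> real \<Rightarrow> (real \<Rightarrow> real) \<Rightarrow> real set \<Rightarrow> (real \<Rightarrow> 'v \<Rightarrow> real) \<Rightarrow> bool" where
  "gde_solution V E d f J u \<longleftrightarrow>
     (\<forall>t\<in>J. bounded (u t ` V) \<and> uniform_limit V u (u t) (at t within J)) \<and>
     (\<forall>t\<in>J. t > 0 \<longrightarrow> (\<forall>i\<in>V. ((\<lambda>s. u s i) has_real_derivative gde_rhs V E d f (u t) i) (at t)))"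

definition linf_dist :: "'v set \<Rightarrow> ('v \<Rightarrow> real) \<Rightarrow> ('v \<Rightarrow> real) \<Rightarrow> real" where
  "linf_dist V u w = (SUP i\<in>V. \<bar>u i - w i\<bar>)"

definition reduced_rhs ::
    "real \<Rightarrow> nat \<Rightarrow> nat ^ 'n ^ 'n \<Rightarrow> (real \<Rightarrow> real) \<Rightarrow> real ^ 'n \<Rightarrow> real ^ 'n" where
  "reduced_rhs d k m f v =
     d *\<^sub>R (map_matrix real m *v v - real k *\<^sub>R v) + (\<chi> c. f (v $ c))"

definition reduced_solution ::
    "real \<Rightarrow> nat \<Rightarrow> nat ^ 'n ^ 'n \<Rightarrow> (real \<Rightarrow> real) \<Rightarrow> real set \<Rightarrow> (real \<Rightarrow> real ^ 'n) \<Rightarrow> bool" where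
  "reduced_solution d k m f J v \<longleftrightarrow>
     continuous_on J v \<and>
     (\<forall>t\<in>J. t > 0 \<longrightarrow> (v has_vector_derivative reduced_rhs d k m f (v t)) (at t))"

text \<open>Lyapunov stability plus attractivity of a stationary solution \<open>x0\<close>. Here \<open>sol J x\<close> says that
  \<open>x\<close> is a solution on \<open>J\<close>, and \<open>dst\<close> is the metric of the state space. As \<open>f\<close> is only continuous,
  solutions need be neither unique nor global: the conditions concern every solution with the
  given initial state, and the stability estimate has to hold for as long as the solution exists
  (a solution on \<open>{0..}\<close> is covered through its restrictions to \<open>{0..<T}\<close>).\<close>

definition asymptotically_stable ::
    "(real set \<Rightarrow> (real \<Rightarrow> 's) \<Rightarrow> bool) \<Rightarrow> ('s \<Rightarrow> 's \<Rightarrow> real) \<Rightarrow> 's \<Rightarrow> bool" where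
  "asymptotically_stable sol dst x0 \<longleftrightarrow>
     sol {0..} (\<lambda>_. x0) \<and>
     (\<forall>\<epsilon>>0. \<exists>\<delta>>0. \<forall>T>0. \<forall>x. sol {0..<T} x \<longrightarrow> dst (x 0) x0 < \<delta> \<longrightarrow>
        (\<forall>t\<in>{0..<T}. dst (x t) x0 < \<epsilon>)) \<and>
     (\<exists>\<eta>>0. \<forall>x. sol {0..} x \<longrightarrow> dst (x 0) x0 < \<eta> \<longrightarrow>
        ((\<lambda>t. dst (x t) x0) \<longlongrightarrow> 0) at_top)"

end

theory Submission
  imports Defs
begin

text \<open>
  The state \<open>u i = v $ \<Gamma> i\<close> is stationary because a vertex of colour \<open>c\<close> has exactly \<open>m $ c $ c'\<close>
  neighbours of colour \<open>c'\<close>: along states that are constant on colour classes the graph equation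
  is the reduced system (\<open>gde_rhs_lift\<close>). The same observation lifts every solution of the
  reduced system to a graph solution, with comparable distances when all colours occur, so
  stability of \<open>u\<close> implies stability of \<open>v\<close>.

  For the converse, arbitrary perturbations of \<open>u\<close>, not constant on colour classes, must be
  controlled. The diffusion is cooperative, so graph solutions obey a comparison principle: if
  every initial value at a vertex of colour \<open>c\<close> lies between \<open>v $ c - \<delta>\<close> and \<open>v $ c + \<delta>\<close>, the
  solution should stay between the solutions of the reduced system from \<open>v - \<delta>\<close> and \<open>v + \<delta>\<close>, and
  these stay near \<open>v\<close> and converge to it.

  As \<open>f\<close> is only continuous, initial value problems have neither unique nor evidently existing
  solutions, and comparison holds only with strict supersolutions. Both points are settled at once
  by \<open>solution_as_limit_of_strict_supersolutions\<close>: for a bounded, uniformly continuous,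
  quasimonotone field there is a solution that is a limit of strict supersolutions, obtained from
  integral equations with a small delay. It applies to the reduced system truncated outside a cube
  around \<open>v\<close>. Strict supersolutions dominate the graph solutions
  (\<open>gde_solution_below_strict_supersolution\<close>), where uniformity over infinitely many vertices comes
  from the continuity of solutions in the supremum norm. Stability of \<open>v\<close>, by continuous induction
  in time, keeps all curves where the truncation is invisible
  (\<open>reduced_solution_above_gde_solutions\<close>, \<open>gde_solutions_between_reduced_solutions\<close>). Lower
  bounds follow by reflection.
\<close>

section \<open>Comparison by continuous induction\<close>

text \<open>
  Continuous induction for a family of curves. Let \<open>s\<close> be the infimum of the times at which some
  curve is below the weak bound \<open>a\<close>. Before \<open>s\<close> all curves satisfy \<open>a\<close>, hence the strong bound
  \<open>b\<close>, and this survives the limit at \<open>s\<close>. Since \<open>b - a > 0\<close> and the continuity in time is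
  uniform over the family, \<open>a\<close> then holds for all curves on a common interval beyond \<open>s\<close>, a
  contradiction.
\<close>

lemma barrier_bootstrap:
  fixes p :: "real \<Rightarrow> 'a \<Rightarrow> real"
  assumes unif: "\<And>t. t \<in> {0..<T} \<Longrightarrow> uniform_limit A p (p t) (at t within {0..<T})"
    and init: "\<And>i. i \<in> A \<Longrightarrow> b \<le> p 0 i" and "a < b"
    and step: "\<And>S. 0 < S \<Longrightarrow> S \<le> T \<Longrightarrow> \<forall>t\<in>{0..<S}. \<forall>i\<in>A. a \<le> p t i
                 \<Longrightarrow> \<forall>t\<in>{0..<S}. \<forall>i\<in>A. b \<le> p t i"
  shows "\<forall>t\<in>{0..<T}. \<forall>i\<in>A. b \<le> p t i"
proof (cases "\<forall>t\<in>{0..<T}. \<forall>i\<in>A. a \<le> p t i")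
  case True
  show ?thesis
  proof (cases "0 < T")
    case True
    with step[OF True order_refl] \<open>\<forall>t\<in>{0..<T}. \<forall>i\<in>A. a \<le> p t i\<close> show ?thesis by blast
  qed auto
next
  case False
  define N where "N = {t \<in> {0..<T}. \<exists>i\<in>A. p t i < a}"
  define s where "s = Inf N"
  have "N \<noteq> {}" using False by (auto simp: N_def not_le)
  have bdd: "bdd_below N" by (auto simp: N_def intro!: bdd_belowI[of _ 0])
  obtain t1 where "t1 \<in> N" using \<open>N \<noteq> {}\<close> by blast
  have s: "0 \<le> s" "s < T"
  proof -
    show "0 \<le> s" unfolding s_def using \<open>N \<noteq> {}\<close> by (rule cInf_greatest) (auto simp: N_def)
    have "s \<le> t1" unfolding s_def using \<open>t1 \<in> N\<close> bdd by (rule cInf_lower)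
    then show "s < T" using \<open>t1 \<in> N\<close> by (auto simp: N_def)
  qed
  have below: "\<forall>t\<in>{0..<s}. \<forall>i\<in>A. a \<le> p t i"
  proof (intro ballI)
    fix t i assume "t \<in> {0..<s}" "i \<in> A"
    then have "t \<notin> N" using cInf_lower[OF _ bdd, of t] by (auto simp: s_def)
    then show "a \<le> p t i" using \<open>t \<in> {0..<s}\<close> \<open>i \<in> A\<close> s by (auto simp: N_def not_less)
  qed
  have at_s: "b \<le> p s i" if "i \<in> A" for i
  proof (cases "s = 0")
    case True
    then show ?thesis using init that by simp
  next
    case False
    then have "0 < s" using s by simp
    have "\<forall>t\<in>{0..<s}. \<forall>i\<in>A. b \<le> p t i" using step[OF \<open>0 < s\<close>] s below by auto
    moreover have "((\<lambda>t. p t i) \<longlongrightarrow> p s i) (at s within {0..<T})"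
      using tendsto_uniform_limitI[OF unif that] s by auto
    then have "((\<lambda>t. p t i) \<longlongrightarrow> p s i) (at s within {0..<s})"
      by (rule tendsto_within_subset) (use s in auto)
    moreover have "at s within {0..<s} \<noteq> bot"
      using \<open>0 < s\<close> by (simp add: trivial_limit_within islimpt_Ico)
    ultimately show ?thesis
      using that by (intro tendsto_lowerbound[of "\<lambda>t. p t i" _ "at s within {0..<s}"])
        (auto simp: eventually_at_filter)
  qed
  have "\<forall>\<^sub>F t in at s within {0..<T}. \<forall>i\<in>A. dist (p t i) (p s i) < b - a"
    using unif[of s] s \<open>a < b\<close> by (intro uniform_limitD) auto
  then obtain e where "e > 0"
    and e: "\<And>t i. t \<in> {0..<T} \<Longrightarrow> t \<noteq> s \<Longrightarrow> dist t s < e \<Longrightarrow> i \<in> A \<Longrightarrow> dist (p t i) (p s i) < b - a"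
    unfolding eventually_at by blast
  obtain t where t: "t \<in> N" "t < s + e"
    using cInf_lessD[OF \<open>N \<noteq> {}\<close>, of "s + e"] \<open>e > 0\<close> by (auto simp: s_def)
  have "s \<le> t" unfolding s_def using t bdd by (intro cInf_lower)
  obtain i where i: "i \<in> A" "p t i < a" and "t \<in> {0..<T}" using t by (auto simp: N_def)
  have "a \<le> p t i"
  proof (cases "t = s")
    case True
    then show ?thesis using at_s[OF \<open>i \<in> A\<close>] \<open>a < b\<close> by simp
  next
    case False
    then have "dist (p t i) (p s i) < b - a"
      using e[OF \<open>t \<in> {0..<T}\<close>] \<open>s \<le> t\<close> t i by (auto simp: dist_real_def)
    then show ?thesis using at_s[OF \<open>i \<in> A\<close>] by (auto simp: dist_real_def)
  qed
  then show ?thesis using i by simp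
qed

text \<open>
  After the last time at which \<open>p\<close> is at least \<open>\<rho>\<close>, the curve would have to increase strictly,
  starting from a value that is at least \<open>\<rho>\<close>.
\<close>

lemma stays_above_if_increasing_below:
  fixes p :: "real \<Rightarrow> real"
  assumes cont: "continuous_on {0..<S} p" and "\<rho> \<le> p 0"
    and inc: "\<And>t. 0 < t \<Longrightarrow> t < S \<Longrightarrow> p t < \<rho> \<Longrightarrow> \<exists>D>0. (p has_real_derivative D) (at t)"
    and t: "t \<in> {0..<S}"
  shows "\<rho> \<le> p t"
proof (rule ccontr)
  assume "\<not> \<rho> \<le> p t"
  define K where "K = {0..t} \<inter> p -` {\<rho>..}"
  have ct: "continuous_on {0..t} p" using cont by (rule continuous_on_subset) (use t in auto)
  have "closed K" unfolding K_def using ct by (intro continuous_closed_preimage) auto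
  moreover have "bounded K" unfolding K_def by (rule bounded_subset[of "{0..t}"]) auto
  ultimately have "compact K" by (simp add: compact_eq_bounded_closed)
  moreover have "0 \<in> K" using assms t by (auto simp: K_def)
  ultimately obtain s where s: "s \<in> K" and smax: "\<And>x. x \<in> K \<Longrightarrow> x \<le> s"
    using compact_attains_sup[of K] by blast
  have "s < t" using s \<open>\<not> \<rho> \<le> p t\<close> by (cases "s = t") (auto simp: K_def)
  have "p s < p t"
  proof (rule DERIV_pos_imp_increasing_open[OF \<open>s < t\<close>])
    show "continuous_on {s..t} p" using ct by (rule continuous_on_subset) (use s in \<open>auto simp: K_def\<close>)
    fix x assume x: "s < x" "x < t"
    then have "p x < \<rho>" using smax[of x] s by (auto simp: K_def not_le[symmetric])
    then show "\<exists>y. (p has_real_derivative y) (at x) \<and> 0 < y"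
      using inc[of x] x s t by (auto simp: K_def)
  qed
  then show False using s \<open>\<not> \<rho> \<le> p t\<close> by (auto simp: K_def)
qed

text \<open>
  The comparison principle behind everything: \<open>p t i\<close> is the gap between an upper and a lower curve
  with index \<open>i\<close>. The derivative of a gap needs to be positive only while all gaps are
  nonnegative and this one is smaller than \<open>\<rho>\<close>; this is what quasimonotonicity provides. One
  \<open>\<rho>\<close> serves all indices, which makes the principle applicable to infinitely many vertices.
\<close>

lemma strict_comparison:
  fixes p :: "real \<Rightarrow> 'a \<Rightarrow> real"
  assumes unif: "\<And>t. t \<in> {0..<T} \<Longrightarrow> uniform_limit A p (p t) (at t within {0..<T})"
    and init: "\<And>i. i \<in> A \<Longrightarrow> \<rho> \<le> p 0 i" and "0 < \<rho>"
    and inc: "\<And>t i. 0 < t \<Longrightarrow> t < T \<Longrightarrow> i \<in> A \<Longrightarrow> \<forall>j\<in>A. 0 \<le> p t j \<Longrightarrow> p t i < \<rho>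
                \<Longrightarrow> \<exists>D>0. ((\<lambda>s. p s i) has_real_derivative D) (at t)"
  shows "\<forall>t\<in>{0..<T}. \<forall>i\<in>A. \<rho> \<le> p t i"
proof (rule barrier_bootstrap[OF unif init \<open>0 < \<rho>\<close>])
  fix S assume S: "0 < S" "S \<le> T" and nonneg: "\<forall>t\<in>{0..<S}. \<forall>i\<in>A. 0 \<le> p t i"
  show "\<forall>t\<in>{0..<S}. \<forall>i\<in>A. \<rho> \<le> p t i"
  proof (intro ballI)
    fix t i assume t: "t \<in> {0..<S}" and i: "i \<in> A"
    have "((\<lambda>s. p s i) \<longlongrightarrow> p x i) (at x within {0..<S})" if "x \<in> {0..<S}" for x
      by (rule tendsto_within_subset[OF tendsto_uniform_limitI[OF unif i]]) (use that S in auto)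
    then have "continuous_on {0..<S} (\<lambda>s. p s i)" by (auto simp: continuous_on_def)
    then show "\<rho> \<le> p t i"
      by (rule stays_above_if_increasing_below[where S = S]) (use S nonneg i t init in \<open>auto intro!: inc\<close>)
  qed
qed

section \<open>Integral equations with delay\<close>

lemma continuous_on_atLeast_if_initial_segments:
  fixes y :: "real \<Rightarrow> 'a::topological_space"
  assumes "\<And>b. continuous_on {0..b} y"
  shows "continuous_on {0..} y"
  unfolding continuous_on_def
proof
  fix x :: real assume "x \<in> {0..}"
  have "at x within {0..} = at x within {0..x + 1}"
    by (rule at_within_nhd[of _ "{..<x + 1}"]) (use \<open>x \<in> {0..}\<close> in auto)
  then show "(y \<longlongrightarrow> y x) (at x within {0..})"
    using assms[of "x + 1"] \<open>x \<in> {0..}\<close> by (auto simp: continuous_on_def)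
qed

lemma integral_curve:
  fixes g y :: "real \<Rightarrow> 'a::banach"
  assumes g: "continuous_on {0..} g" and y: "\<And>t. 0 \<le> t \<Longrightarrow> y t = a + integral {0..t} g"
  shows "continuous_on {0..} y"
    and "0 < t \<Longrightarrow> (y has_vector_derivative g t) (at t)"
proof -
  have g': "continuous_on {0..b} g" for b using g by (rule continuous_on_subset) auto
  have der: "(y has_vector_derivative g t) (at t within {0..b})" if "0 \<le> t" "t \<le> b" for t b
  proof -
    have "((\<lambda>t. a + integral {0..t} g) has_vector_derivative 0 + g t) (at t within {0..b})"
      using that by (intro has_vector_derivative_add has_vector_derivative_const
        integral_has_vector_derivative g') auto
    then show ?thesis
      using has_vector_derivative_transform[of t "{0..b}" y] that y by auto
  qed
  show "continuous_on {0..} y"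
  proof (rule continuous_on_atLeast_if_initial_segments)
    fix b show "continuous_on {0..b} y"
      unfolding continuous_on_eq_continuous_within
      using has_vector_derivative_continuous[OF der] by auto
  qed
  show "(y has_vector_derivative g t) (at t)" if "0 < t"
    using der[of t "t + 1"] that by (simp add: at_within_Icc_at)
qed

text \<open>
  With a delay \<open>h\<close> the right-hand side on \<open>[j h, (j + 1) h]\<close> only involves the values of \<open>y\<close> on
  \<open>[0, j h]\<close>, so the equation is solved by steps. Each Picard iterate extends the correct part by
  one step of length \<open>h\<close>.
\<close>

lemma delayed_integral_equation:
  fixes H :: "'a::banach \<Rightarrow> 'a" and h :: real
  assumes H: "continuous_on UNIV H" and "0 < h"
  shows "\<exists>y. continuous_on {0..} y \<and> (\<forall>t\<ge>0. y t = a + integral {0..t} (\<lambda>s. H (y (max 0 (s - h)))))"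
proof -
  define w where "w = rec_nat (\<lambda>_. a) (\<lambda>_ w t. a + integral {0..t} (\<lambda>s. H (w (max 0 (s - h)))))"
  have w_0: "w 0 = (\<lambda>_. a)"
    and w_Suc: "w (Suc j) = (\<lambda>t. a + integral {0..t} (\<lambda>s. H (w j (max 0 (s - h)))))" for j
    by (simp_all add: w_def)
  have cont_arg: "continuous_on {0..} (\<lambda>s. H (x (max 0 (s - h))))"
    if "continuous_on {0..} x" for x
    by (intro continuous_on_compose2[OF H] continuous_on_compose2[OF that]
        continuous_on_max continuous_intros) auto
  have cont: "continuous_on {0..} (w j)" for j
  proof (induction j)
    case (Suc j)
    show ?case by (rule integral_curve(1)[OF cont_arg[OF Suc]]) (simp add: w_Suc)
  qed (simp add: w_0)
  have step: "w (Suc j) t = w j t" if "0 \<le> t" "t \<le> real j * h" for j t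
    using that
  proof (induction j arbitrary: t)
    case 0
    then show ?case by (simp add: w_Suc w_0)
  next
    case (Suc j)
    have "H (w (Suc j) (max 0 (s - h))) = H (w j (max 0 (s - h)))" if "s \<in> {0..t}" for s
    proof -
      have "max 0 (s - h) \<le> real j * h" using that Suc.prems \<open>0 < h\<close> by (auto simp: algebra_simps)
      then show ?thesis using Suc.IH by simp
    qed
    then have "integral {0..t} (\<lambda>s. H (w (Suc j) (max 0 (s - h))))
        = integral {0..t} (\<lambda>s. H (w j (max 0 (s - h))))"
      by (rule integral_cong)
    then show ?case by (simp only: w_Suc[of "Suc j"] w_Suc[of j])
  qed
  have agree: "w i t = w j t" if "0 \<le> t" "t \<le> real j * h" "j \<le> i" for i j t
    using \<open>j \<le> i\<close>
  proof (induction i rule: dec_induct)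
    case (step i)
    have "real j * h \<le> real i * h" using step(1) \<open>0 < h\<close> by (simp add: mult_right_mono)
    then show ?case using step that \<open>\<And>j t. 0 \<le> t \<Longrightarrow> t \<le> real j * h \<Longrightarrow> w (Suc j) t = w j t\<close>[of t i] by simp
  qed simp
  \<comment> \<open>At time \<open>t\<close> the iterates are constant from the index \<open>\<lceil>t / h\<rceil>\<close> on.\<close>
  define y where "y t = w (nat \<lceil>t / h\<rceil>) t" for t
  have y_eq: "y t = w j t" if "0 \<le> t" "t \<le> real j * h" for t j
  proof -
    have "t / h \<le> real (nat \<lceil>t / h\<rceil>)" by (rule real_nat_ceiling_ge)
    then have "t \<le> real (nat \<lceil>t / h\<rceil>) * h" using \<open>0 < h\<close> by (simp add: field_simps)
    moreover have "nat \<lceil>t / h\<rceil> \<le> j" using that \<open>0 < h\<close> by (simp add: nat_ceiling_le_eq field_simps)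
    ultimately show ?thesis unfolding y_def using agree[of t "nat \<lceil>t / h\<rceil>" j] that by simp
  qed
  have ex_j: "\<exists>j. t \<le> real j * h" for t
    using real_arch_simple[of "t / h"] \<open>0 < h\<close> by (auto simp: field_simps)
  have "continuous_on {0..b} y" for b
  proof -
    obtain j where j: "b \<le> real j * h" using ex_j by blast
    have "continuous_on {0..b} (w j)" using cont[of j] by (rule continuous_on_subset) auto
    then show ?thesis
    proof (rule continuous_on_eq)
      fix t assume "t \<in> {0..b}"
      then have "0 \<le> t" "t \<le> real j * h" using j by auto
      then show "w j t = y t" by (simp add: y_eq)
    qed
  qed
  moreover have "y t = a + integral {0..t} (\<lambda>s. H (y (max 0 (s - h))))" if "0 \<le> t" for t
  proof -
    obtain j where j: "t \<le> real j * h" using ex_j by blast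
    moreover have "real j * h \<le> real (Suc j) * h" using \<open>0 < h\<close> by simp
    ultimately have "y t = w (Suc j) t" using y_eq[of t "Suc j"] that by linarith
    also have "\<dots> = a + integral {0..t} (\<lambda>s. H (w j (max 0 (s - h))))" by (simp add: w_Suc)
    also have "integral {0..t} (\<lambda>s. H (w j (max 0 (s - h)))) = integral {0..t} (\<lambda>s. H (y (max 0 (s - h))))"
    proof (rule integral_cong)
      fix s assume "s \<in> {0..t}"
      then have "0 \<le> max 0 (s - h)" "max 0 (s - h) \<le> real j * h" using j that \<open>0 < h\<close> by auto
      then show "H (w j (max 0 (s - h))) = H (y (max 0 (s - h)))" by (simp add: y_eq)
    qed
    finally show ?thesis .
  qed
  ultimately show ?thesis
    by (intro exI[of _ y] conjI allI impI continuous_on_atLeast_if_initial_segments)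
qed

section \<open>A solution approximated by strict supersolutions\<close>

text \<open>The Kamke condition, which defines cooperative systems.\<close>

definition quasimonotone :: "(real ^ 'n \<Rightarrow> real ^ 'n) \<Rightarrow> bool" where
  "quasimonotone H \<longleftrightarrow> (\<forall>x y c. x \<le> y \<longrightarrow> x $ c = y $ c \<longrightarrow> H x $ c \<le> H y $ c)"

definition strict_supersolution ::
    "(real ^ 'n \<Rightarrow> real ^ 'n) \<Rightarrow> real ^ 'n \<Rightarrow> (real \<Rightarrow> real ^ 'n) \<Rightarrow> bool" where
  "strict_supersolution H a y \<longleftrightarrow> continuous_on {0..} y \<and>
     (\<exists>\<eta>>0. (\<forall>c. a $ c + \<eta> \<le> y 0 $ c) \<and>
        (\<forall>t>0. \<exists>D. (y has_vector_derivative D) (at t) \<and> (\<forall>c. H (y t) $ c + \<eta> \<le> D $ c)))"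

text \<open>
  The Kamke condition compares \<open>x\<close> and \<open>y\<close> only where their components \<open>c\<close> agree. Lowering \<open>y $ c\<close> to
  \<open>x $ c\<close> establishes this, and uniform continuity bounds the error of doing so.
\<close>

lemma quasimonotone_uniform:
  fixes H :: "real ^ 'n \<Rightarrow> real ^ 'n"
  assumes H: "quasimonotone H" and uc: "uniformly_continuous_on UNIV H" and "0 < e"
  obtains \<rho> where "0 < \<rho>"
    "\<And>x y c. x \<le> y \<Longrightarrow> y $ c - x $ c < \<rho> \<Longrightarrow> H x $ c - H y $ c < e"
proof -
  obtain \<rho> where "0 < \<rho>" and \<rho>: "\<And>x y. dist x y < \<rho> \<Longrightarrow> dist (H x) (H y) < e"
    using uc \<open>0 < e\<close> unfolding uniformly_continuous_on_def by (metis UNIV_I)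
  show ?thesis
  proof (rule that[OF \<open>0 < \<rho>\<close>])
    fix x y :: "real ^ 'n" and c assume le: "x \<le> y" and less: "y $ c - x $ c < \<rho>"
    define z where "z = y - axis c (y $ c - x $ c)"
    have "H x $ c \<le> H z $ c"
      using H le unfolding quasimonotone_def
      by (auto simp: z_def axis_def less_eq_vec_def)
    moreover have "dist z y < \<rho>"
      using less le by (simp add: z_def dist_norm norm_eq_sqrt_inner inner_axis_axis less_eq_vec_def)
    then have "dist (H z) (H y) < e" by (rule \<rho>)
    then have "H z $ c - H y $ c < e"
      using component_le_norm_cart[of "H z - H y" c] by (simp add: dist_norm)
    ultimately show "H x $ c - H y $ c < e" by simp
  qed
qed

text \<open>
  The field is evaluated with a small delay and raised by \<open>2 \<eta>\<close>. Since \<open>H\<close> is bounded, \<open>y\<close> is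
  Lipschitz, so for a short delay the delayed and the present field differ by at most \<open>\<eta>\<close> and the
  slope exceeds the field by an amount between \<open>\<eta>\<close> and \<open>3 \<eta>\<close>.
\<close>

lemma approximate_supersolution:
  fixes H :: "real ^ 'n \<Rightarrow> real ^ 'n"
  assumes uc: "uniformly_continuous_on UNIV H" and B: "\<And>x. norm (H x) \<le> B" and "0 < \<eta>"
  shows "\<exists>y g :: real \<Rightarrow> real ^ 'n. continuous_on {0..} y \<and> continuous_on {0..} g \<and>
    (\<forall>t\<ge>0. y t = a + vec \<eta> + integral {0..t} g) \<and>
    (\<forall>t\<ge>0. norm (g t) \<le> B + norm (vec (2 * \<eta>) :: real ^ 'n)) \<and>
    (\<forall>t\<ge>0. \<forall>c. H (y t) $ c + \<eta> \<le> g t $ c \<and> g t $ c \<le> H (y t) $ c + 3 * \<eta>)"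
proof -
  define F where "F x = H x + vec (2 * \<eta>)" for x
  define B' where "B' = B + norm (vec (2 * \<eta>) :: real ^ 'n)"
  have cont_H: "continuous_on UNIV H" using uc by (rule uniformly_continuous_imp_continuous)
  have cont_F: "continuous_on UNIV F" unfolding F_def by (intro continuous_intros cont_H)
  have F_le: "norm (F x) \<le> B'" for x
    unfolding F_def B'_def using norm_triangle_ineq[of "H x" "vec (2 * \<eta>)"] B[of x] by linarith
  have "0 \<le> B'" using order_trans[OF norm_ge_zero F_le] .
  obtain \<rho> where "0 < \<rho>" and \<rho>: "\<And>x y. dist x y < \<rho> \<Longrightarrow> dist (H x) (H y) < \<eta>"
    using uc \<open>0 < \<eta>\<close> unfolding uniformly_continuous_on_def by (metis UNIV_I)
  define h where "h = \<rho> / (B' + 1)"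
  have "0 < h" and h: "B' * h < \<rho>"
    using \<open>0 < \<rho>\<close> \<open>0 \<le> B'\<close> by (auto simp: h_def field_simps)
  obtain y where cont_y: "continuous_on {0..} y"
    and y: "\<And>t. 0 \<le> t \<Longrightarrow> y t = a + vec \<eta> + integral {0..t} (\<lambda>s. F (y (max 0 (s - h))))"
    using delayed_integral_equation[OF cont_F \<open>0 < h\<close>, of "a + vec \<eta>"] by blast
  define g where "g s = F (y (max 0 (s - h)))" for s
  have cont_g: "continuous_on {0..} g" unfolding g_def
    by (intro continuous_on_compose2[OF cont_F] continuous_on_compose2[OF cont_y]
        continuous_on_max continuous_intros) auto
  have y: "y t = a + vec \<eta> + integral {0..t} g" if "0 \<le> t" for t
    using y[OF that] unfolding g_def .
  have near: "dist (y (max 0 (t - h))) (y t) < \<rho>" if "0 \<le> t" for t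
  proof -
    let ?s = "max 0 (t - h)"
    have s: "0 \<le> ?s" "?s \<le> t" "t - ?s \<le> h" using that \<open>0 < h\<close> by auto
    have int: "g integrable_on {u..v}" if "0 \<le> u" for u v
      by (intro integrable_continuous_real continuous_on_subset[OF cont_g]) (use that in auto)
    have "integral {0..?s} g + integral {?s..t} g = integral {0..t} g"
      by (rule Henstock_Kurzweil_Integration.integral_combine) (use s int in auto)
    then have "y t - y ?s = integral {?s..t} g" using y[of t] y[of ?s] s that by (simp add: algebra_simps)
    then have "dist (y ?s) (y t) = norm (integral {?s..t} g)" by (metis dist_norm dist_commute)
    moreover have "norm (integral {?s..t} g) \<le> B' * (t - ?s)"
    proof (rule integral_bound)
      show "continuous_on {?s..t} g" by (rule continuous_on_subset[OF cont_g]) auto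
    qed (use s F_le in \<open>auto simp: g_def\<close>)
    moreover have "B' * (t - ?s) \<le> B' * h" using s(3) \<open>0 \<le> B'\<close> by (rule mult_left_mono)
    ultimately show ?thesis using h by linarith
  qed
  have "H (y t) $ c + \<eta> \<le> g t $ c \<and> g t $ c \<le> H (y t) $ c + 3 * \<eta>" if "0 \<le> t" for t c
  proof -
    have "\<bar>(H (y (max 0 (t - h))) - H (y t)) $ c\<bar> < \<eta>"
      using component_le_norm_cart[of "H (y (max 0 (t - h))) - H (y t)" c] \<rho>[OF near[OF that]]
      unfolding dist_norm by linarith
    then show ?thesis by (auto simp: g_def F_def abs_less_iff)
  qed
  moreover have "norm (g t) \<le> B'" for t by (simp add: g_def F_le)
  moreover note cont_y cont_g y
  ultimately show ?thesis unfolding B'_def[symmetric] by blast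
qed

lemma uniform_limit_vec_components:
  fixes y :: "real \<Rightarrow> real ^ 'n"
  assumes "(y \<longlongrightarrow> y t) F"
  shows "uniform_limit A (\<lambda>s i. y s $ \<gamma> i) (\<lambda>i. y t $ \<gamma> i) F"
proof (rule uniform_limitI)
  fix e :: real assume "0 < e"
  have "\<forall>\<^sub>F s in F. dist (y s) (y t) < e" using assms \<open>0 < e\<close> by (rule tendstoD)
  then show "\<forall>\<^sub>F s in F. \<forall>i\<in>A. dist (y s $ \<gamma> i) (y t $ \<gamma> i) < e"
    by eventually_elim (use dist_vec_nth_le le_less_trans in blast)
qed

lemma has_real_derivative_component:
  fixes y :: "real \<Rightarrow> real ^ 'n"
  assumes "(y has_vector_derivative D) (at t)"
  shows "((\<lambda>s. y s $ c) has_real_derivative D $ c) (at t)"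
  using bounded_linear.has_vector_derivative[OF bounded_linear_vec_nth assms]
  by (simp add: has_real_derivative_iff_has_vector_derivative)

text \<open>
  Peano's existence theorem with one-sided approximation; the limit is the maximal solution from \<open>a\<close>.
  With the margins \<open>4 ^ (- n)\<close> the slope of the next approximation exceeds the field by at most
  \<open>3 / 4\<close> of the present margin, so comparison makes the approximations decrease in \<open>n\<close>. They
  therefore converge pointwise, and dominated convergence passes to the limit in the integral
  equation. A supersolution that is strict can be compared with any solution from below, although
  solutions of the equation need not be unique; that is why the approximations are part of the claim.
\<close>

theorem solution_as_limit_of_strict_supersolutions:
  fixes H :: "real ^ 'n \<Rightarrow> real ^ 'n"
  assumes qm: "quasimonotone H" and uc: "uniformly_continuous_on UNIV H"
    and B: "\<And>x. norm (H x) \<le> B"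
  shows "\<exists>y w. (\<forall>n. strict_supersolution H a (y n)) \<and> (\<forall>t\<ge>0. (\<lambda>n. y n t) \<longlonglongrightarrow> w t) \<and>
    continuous_on {0..} w \<and> w 0 = a \<and> (\<forall>t>0. (w has_vector_derivative H (w t)) (at t))"
proof -
  define \<eta> :: "nat \<Rightarrow> real" where "\<eta> n = (1 / 4) ^ n" for n
  have \<eta>: "0 < \<eta> n" "\<eta> (Suc n) = \<eta> n / 4" "\<eta> n \<le> 1" for n
    by (simp_all add: \<eta>_def power_le_one)
  have \<eta>_lim: "\<eta> \<longlonglongrightarrow> 0" unfolding \<eta>_def by (intro LIMSEQ_realpow_zero) auto
  define approx where "approx n y g \<longleftrightarrow> continuous_on {0..} y \<and> continuous_on {0..} g \<and>
    (\<forall>t\<ge>0. y t = a + vec (\<eta> n) + integral {0..t} g) \<and>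
    (\<forall>t\<ge>0. norm (g t) \<le> B + norm (vec (2 * \<eta> n) :: real ^ 'n)) \<and>
    (\<forall>t\<ge>0. \<forall>c. H (y t) $ c + \<eta> n \<le> g t $ c \<and> g t $ c \<le> H (y t) $ c + 3 * \<eta> n)"
    for n and y g :: "real \<Rightarrow> real ^ 'n"
  have "\<forall>n. \<exists>y g. approx n y g"
    unfolding approx_def using approximate_supersolution[OF uc B \<eta>(1)] by blast
  then obtain y g where "\<And>n. approx n (y n) (g n)" by metis
  then have cont_y: "\<And>n. continuous_on {0..} (y n)"
    and cont_g: "\<And>n. continuous_on {0..} (g n)"
    and y: "\<And>n t. 0 \<le> t \<Longrightarrow> y n t = a + vec (\<eta> n) + integral {0..t} (g n)"
    and g_bound: "\<And>n t. 0 \<le> t \<Longrightarrow> norm (g n t) \<le> B + norm (vec (2 * \<eta> n) :: real ^ 'n)"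
    and g_lower: "\<And>n t c. 0 \<le> t \<Longrightarrow> H (y n t) $ c + \<eta> n \<le> g n t $ c"
    and g_upper: "\<And>n t c. 0 \<le> t \<Longrightarrow> g n t $ c \<le> H (y n t) $ c + 3 * \<eta> n"
    unfolding approx_def by blast+
  define B' where "B' = B + norm (vec 2 :: real ^ 'n)"
  have norm_vec_mono: "norm (vec r :: real ^ 'n) \<le> norm (vec s :: real ^ 'n)" if "\<bar>r\<bar> \<le> \<bar>s\<bar>" for r s
    using that by (intro norm_le_componentwise_cart) simp
  have g_le: "norm (g n t) \<le> B'" if "0 \<le> t" for n t
    using g_bound[OF that, of n] norm_vec_mono[of "2 * \<eta> n" 2] \<eta>(1)[of n] \<eta>(3)[of n]
    unfolding B'_def by linarith
  have der_y: "(y n has_vector_derivative g n t) (at t)" if "0 < t" for n t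
    using integral_curve(2)[OF cont_g y that] .
  have y_0: "y n 0 = a + vec (\<eta> n)" for n using y[of 0 n] by simp
  have super: "strict_supersolution H a (y n)" for n
    unfolding strict_supersolution_def
  proof (intro conjI exI[of _ "\<eta> n"] allI impI)
    fix t :: real assume "0 < t"
    then show "\<exists>D. (y n has_vector_derivative D) (at t) \<and> (\<forall>c. H (y n t) $ c + \<eta> n \<le> D $ c)"
      using der_y g_lower by (intro exI[of _ "g n t"]) auto
  qed (use cont_y \<eta> y_0 in auto)

  \<comment> \<open>A quarter of the margin \<open>\<eta> n\<close> is left to absorb the error of quasimonotonicity.\<close>
  have decreasing: "y (Suc n) t $ c \<le> y n t $ c" if "0 \<le> t" for n t c
  proof -
    obtain \<rho>0 where "0 < \<rho>0"
      and \<rho>0: "\<And>x z c. x \<le> z \<Longrightarrow> z $ c - x $ c < \<rho>0 \<Longrightarrow> H x $ c - H z $ c < \<eta> n / 4"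
      using quasimonotone_uniform[OF qm uc, of "\<eta> n / 4"] \<eta>(1)[of n] by auto
    define \<rho> where "\<rho> = min \<rho>0 (\<eta> n / 4)"
    have "0 < \<rho>" using \<open>0 < \<rho>0\<close> \<eta>(1)[of n] by (simp add: \<rho>_def)
    have "\<forall>s\<in>{0..<t + 1}. \<forall>c\<in>UNIV. \<rho> \<le> y n s $ c - y (Suc n) s $ c"
    proof (rule strict_comparison[OF _ _ \<open>0 < \<rho>\<close>])
      fix s assume "s \<in> {0..<t + 1}"
      then have "(y n \<longlongrightarrow> y n s) (at s within {0..<t + 1})" for n
        using cont_y[of n] by (auto simp: continuous_on_def intro: tendsto_within_subset)
      then show "uniform_limit UNIV (\<lambda>s c. y n s $ c - y (Suc n) s $ c)
          (\<lambda>c. y n s $ c - y (Suc n) s $ c) (at s within {0..<t + 1})"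
        by (intro uniform_limit_minus uniform_limit_vec_components)
    next
      fix c show "\<rho> \<le> y n 0 $ c - y (Suc n) 0 $ c"
        using \<eta>(1)[of n] by (simp add: y_0 \<eta>(2) \<rho>_def min_def)
    next
      fix s c assume s: "0 < s" and nonneg: "\<forall>j\<in>UNIV. 0 \<le> y n s $ j - y (Suc n) s $ j"
        and less: "y n s $ c - y (Suc n) s $ c < \<rho>"
      have "H (y (Suc n) s) $ c - H (y n s) $ c < \<eta> n / 4"
        using nonneg less by (intro \<rho>0) (auto simp: less_eq_vec_def \<rho>_def)
      then have "0 < g n s $ c - g (Suc n) s $ c"
        using g_lower[of s n c] g_upper[of s "Suc n" c] s \<eta>(2)[of n] by simp
      moreover have "((\<lambda>s. y n s $ c - y (Suc n) s $ c) has_real_derivative g n s $ c - g (Suc n) s $ c) (at s)"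
        by (intro DERIV_diff has_real_derivative_component der_y s)
      ultimately show "\<exists>D>0. ((\<lambda>s. y n s $ c - y (Suc n) s $ c) has_real_derivative D) (at s)" by blast
    qed
    then have "\<rho> \<le> y n t $ c - y (Suc n) t $ c" using that by simp
    then show ?thesis using \<open>0 < \<rho>\<close> by simp
  qed

  have y_bound: "norm (y n t) \<le> norm a + norm (vec 1 :: real ^ 'n) + B' * t" if "0 \<le> t" for n t
  proof -
    have "norm (integral {0..t} (g n)) \<le> B' * (t - 0)"
      by (intro integral_bound that continuous_on_subset[OF cont_g]) (use g_le in auto)
    moreover have "norm (y n t) \<le> norm a + norm (vec (\<eta> n) :: real ^ 'n) + norm (integral {0..t} (g n))"
      unfolding y[OF that] by (meson norm_triangle_ineq norm_triangle_le add_right_mono order_trans)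
    ultimately show ?thesis using norm_vec_mono[of "\<eta> n" 1] \<eta>(1)[of n] \<eta>(3)[of n] by simp
  qed
  have "convergent (\<lambda>n. y n t)" if "0 \<le> t" for t
  proof -
    have "convergent (\<lambda>n. y n t $ c)" for c
    proof (rule Bseq_monoseq_convergent)
      show "monoseq (\<lambda>n. y n t $ c)" using decreasing[OF that] by (intro decseq_imp_monoseq decseq_SucI)
      show "Bseq (\<lambda>n. y n t $ c)"
      proof (rule BseqI')
        fix n show "norm (y n t $ c) \<le> norm a + norm (vec 1 :: real ^ 'n) + B' * t"
          using y_bound[OF that, of n] component_le_norm_cart[of "y n t" c] by (simp only: real_norm_def)
      qed
    qed
    then have "(\<lambda>n. y n t) \<longlonglongrightarrow> (\<chi> c. lim (\<lambda>n. y n t $ c))"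
      by (intro vec_tendstoI) (simp add: convergent_LIMSEQ_iff)
    then show ?thesis by (rule convergentI)
  qed
  then obtain w where w: "\<And>t. 0 \<le> t \<Longrightarrow> (\<lambda>n. y n t) \<longlonglongrightarrow> w t"
    unfolding convergent_def by metis
  have cont_H: "continuous_on UNIV H" using uc by (rule uniformly_continuous_imp_continuous)
  have g_lim: "(\<lambda>n. g n t) \<longlonglongrightarrow> H (w t)" if "0 \<le> t" for t
  proof (rule vec_tendstoI)
    fix c
    have Hy: "(\<lambda>n. H (y n t)) \<longlonglongrightarrow> H (w t)"
      using continuous_on_tendsto_compose[OF cont_H w[OF that]] by simp
    show "(\<lambda>n. g n t $ c) \<longlonglongrightarrow> H (w t) $ c"
    proof (rule tendsto_sandwich)
      show "(\<lambda>n. H (y n t) $ c + \<eta> n) \<longlonglongrightarrow> H (w t) $ c"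
        using tendsto_add[OF tendsto_vec_nth[OF Hy, of c] \<eta>_lim] by simp
      show "(\<lambda>n. H (y n t) $ c + 3 * \<eta> n) \<longlonglongrightarrow> H (w t) $ c"
        using tendsto_add[OF tendsto_vec_nth[OF Hy, of c] tendsto_mult_left[OF \<eta>_lim, of 3]] by simp
    qed (use g_lower g_upper that in auto)
  qed
  have int_g: "(g n) integrable_on {0..t}" for n t
    by (intro integrable_continuous_real continuous_on_subset[OF cont_g]) auto
  note dom = dominated_convergence[where h = "\<lambda>_. B'", OF int_g]
  have int_H: "(\<lambda>s. H (w s)) integrable_on {0..t}" for t
    by (rule dom(1)) (use g_le g_lim in auto)
  have w_eq: "w t = a + integral {0..t} (\<lambda>s. H (w s))" if "0 \<le> t" for t
  proof (rule LIMSEQ_unique[OF w[OF that]])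
    have "(\<lambda>n. integral {0..t} (g n)) \<longlonglongrightarrow> integral {0..t} (\<lambda>s. H (w s))"
      by (rule dom(2)) (use g_le g_lim in auto)
    moreover have "(\<lambda>n. vec (\<eta> n) :: real ^ 'n) \<longlonglongrightarrow> 0"
      by (intro vec_tendstoI) (simp add: \<eta>_lim)
    ultimately have "(\<lambda>n. a + vec (\<eta> n) + integral {0..t} (g n)) \<longlonglongrightarrow> a + 0 + integral {0..t} (\<lambda>s. H (w s))"
      by (intro tendsto_intros)
    then show "(\<lambda>n. y n t) \<longlonglongrightarrow> a + integral {0..t} (\<lambda>s. H (w s))"
      using that by (simp add: y)
  qed
  have cont_w: "continuous_on {0..} w"
  proof (rule continuous_on_atLeast_if_initial_segments)
    fix b
    have "continuous_on {0..b} (\<lambda>t. a + integral {0..t} (\<lambda>s. H (w s)))"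
      by (intro continuous_intros indefinite_integral_continuous_1 int_H)
    then show "continuous_on {0..b} w" by (rule continuous_on_eq) (simp add: w_eq)
  qed
  have "(w has_vector_derivative H (w t)) (at t)" if "0 < t" for t
    by (rule integral_curve(2)[OF _ w_eq that]) (use continuous_on_compose2[OF cont_H cont_w] in auto)
  moreover have "w 0 = a" using w_eq[of 0] by simp
  ultimately show ?thesis using super w cont_w by blast
qed

section \<open>The reduced system and its truncation\<close>

lemma reduced_rhs_component:
  "reduced_rhs d k m f x $ c = d * ((\<Sum>j\<in>UNIV. real (m $ c $ j) * x $ j) - real k * x $ c) + f (x $ c)"
  by (simp add: reduced_rhs_def matrix_vector_mult_def map_matrix_def)

lemma continuous_on_reduced_rhs:
  fixes m :: "nat ^ 'n ^ 'n"
  assumes "continuous_on UNIV f"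
  shows "continuous_on UNIV (reduced_rhs d k m f)"
proof -
  have "continuous_on UNIV (\<lambda>x :: real ^ 'n. f (x $ c))" for c :: 'n
    by (rule continuous_on_compose2[OF assms]) (auto intro!: continuous_intros)
  then show ?thesis
    unfolding reduced_rhs_def
    by (intro continuous_on_add continuous_on_scaleR continuous_on_diff continuous_on_const
        continuous_on_id continuous_on_vec_lambda)
      (rule linear_continuous_on, rule matrix_vector_mul_bounded_linear)
qed

text \<open>The coupling coefficients \<open>d m\<^sub>c\<^sub>j\<close> are nonnegative.\<close>

lemma quasimonotone_reduced_rhs:
  fixes m :: "nat ^ 'n ^ 'n"
  assumes "0 \<le> d"
  shows "quasimonotone (reduced_rhs d k m f)"
  unfolding quasimonotone_def
proof (intro allI impI)
  fix x y :: "real ^ 'n" and c assume le: "x \<le> y" and eq: "x $ c = y $ c"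
  have "(\<Sum>j\<in>UNIV. real (m $ c $ j) * x $ j) \<le> (\<Sum>j\<in>UNIV. real (m $ c $ j) * y $ j)"
    using le by (intro sum_mono mult_left_mono) (auto simp: less_eq_vec_def)
  then show "reduced_rhs d k m f x $ c \<le> reduced_rhs d k m f y $ c"
    using assms by (simp add: reduced_rhs_component eq mult_left_mono)
qed

text \<open>
  The nearest point of the cube around \<open>v\<close> with half side \<open>r\<close>. Composing the field with it makes the
  field bounded and uniformly continuous, changes nothing near \<open>v\<close>, and keeps quasimonotonicity
  because it acts on each coordinate separately.
\<close>

definition box_clamp :: "real \<Rightarrow> real ^ 'n \<Rightarrow> real ^ 'n \<Rightarrow> real ^ 'n" where
  "box_clamp r v x = (\<chi> c. max (v $ c - r) (min (x $ c) (v $ c + r)))"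

lemma box_clamp_component [simp]:
  "box_clamp r v x $ c = max (v $ c - r) (min (x $ c) (v $ c + r))"
  by (simp add: box_clamp_def)

lemma box_clamp_id:
  assumes "dist x v \<le> r"
  shows "box_clamp r v x = x"
proof -
  have "\<bar>x $ c - v $ c\<bar> \<le> r" for c
    using component_le_norm_cart[of "x - v" c] assms by (simp add: dist_norm)
  then show ?thesis by (simp add: vec_eq_iff abs_le_iff max_def min_def) (smt (verit))
qed

lemma quasimonotone_box_clamp:
  fixes v :: "real ^ 'n"
  assumes "quasimonotone H"
  shows "quasimonotone (\<lambda>x. H (box_clamp r v x))"
  unfolding quasimonotone_def
proof (intro allI impI)
  fix x y :: "real ^ 'n" and c assume "x \<le> y" "x $ c = y $ c"
  moreover from this have "box_clamp r v x \<le> box_clamp r v y"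
    by (simp add: less_eq_vec_def) (smt (verit))
  ultimately show "H (box_clamp r v x) $ c \<le> H (box_clamp r v y) $ c"
    using assms unfolding quasimonotone_def by simp
qed

lemma clamped_field_regular:
  fixes H :: "real ^ 'n \<Rightarrow> real ^ 'n" and v :: "real ^ 'n"
  assumes H: "continuous_on UNIV H" and "0 \<le> r"
  shows "uniformly_continuous_on UNIV (\<lambda>x. H (box_clamp r v x))"
    and "\<exists>B. \<forall>x. norm (H (box_clamp r v x)) \<le> B"
proof -
  define K where "K = cbox (v - vec r) (v + vec r)"
  have "compact K" by (simp add: K_def)
  have range: "box_clamp r v x \<in> K" for x
    using \<open>0 \<le> r\<close> by (simp add: K_def mem_box_cart)
  have HK: "continuous_on K H" using H by (rule continuous_on_subset) simp
  have ucK: "uniformly_continuous_on K H"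
    using HK \<open>compact K\<close> by (rule compact_uniformly_continuous)
  have "dist (box_clamp r v x) (box_clamp r v y) \<le> dist x y" for x y
    unfolding dist_norm by (rule norm_le_componentwise_cart) (simp add: max_def min_def)
  then have "uniformly_continuous_on UNIV (box_clamp r v)"
    unfolding uniformly_continuous_on_def by (meson le_less_trans)
  moreover have "uniformly_continuous_on (range (box_clamp r v)) H"
    using ucK range unfolding uniformly_continuous_on_def by (metis (no_types, lifting) rangeE)
  ultimately show "uniformly_continuous_on UNIV (\<lambda>x. H (box_clamp r v x))"
    by (rule uniformly_continuous_on_compose)
  have "bounded (H ` K)" using compact_continuous_image[OF HK \<open>compact K\<close>] by (rule compact_imp_bounded)
  then show "\<exists>B. \<forall>x. norm (H (box_clamp r v x)) \<le> B"
    using range unfolding bounded_iff by blast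
qed

section \<open>The graph system along a perfect colouring\<close>

lemma sum_over_neighbours:
  assumes "regular_graph k V E" "perfect_coloring V E m \<Gamma>" "i \<in> V"
  shows "(\<Sum>j\<in>nbrs V E i. x $ \<Gamma> j) = (\<Sum>c\<in>UNIV. real (m $ \<Gamma> i $ c) * x $ c)"
proof -
  have fin: "finite (nbrs V E i)" using assms by (simp add: regular_graph_def)
  have "(\<Sum>j\<in>nbrs V E i. x $ \<Gamma> j) = (\<Sum>c\<in>UNIV. \<Sum>j\<in>{j \<in> nbrs V E i. \<Gamma> j = c}. x $ \<Gamma> j)"
    by (rule sum.group[symmetric]) (use fin in auto)
  also have "\<dots> = (\<Sum>c\<in>UNIV. real (card {j \<in> nbrs V E i. \<Gamma> j = c}) * x $ c)"
    by (intro sum.cong) auto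
  finally show ?thesis using assms by (simp add: perfect_coloring_def)
qed

lemma gde_rhs_regular:
  assumes "regular_graph k V E" "i \<in> V"
  shows "gde_rhs V E d f u i = d * ((\<Sum>j\<in>nbrs V E i. u j) - real k * u i) + f (u i)"
  using assms by (simp add: gde_rhs_def sum_subtractf regular_graph_def)

text \<open>
  Neighbours of the same colour contribute equally, and \<open>m\<close> prescribes how many there are of each
  colour.
\<close>

lemma gde_rhs_lift:
  assumes "regular_graph k V E" "perfect_coloring V E m \<Gamma>" "i \<in> V"
  shows "gde_rhs V E d f (\<lambda>j. x $ \<Gamma> j) i = reduced_rhs d k m f x $ \<Gamma> i"
  using assms by (simp add: gde_rhs_regular sum_over_neighbours reduced_rhs_component)

lemma bounded_lift:
  fixes x :: "real ^ 'n"
  shows "bounded ((\<lambda>i. x $ \<Gamma> i) ` V)"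
proof -
  have "finite ((\<lambda>c. x $ c) ` \<Gamma> ` V)" by simp
  then show ?thesis unfolding image_image by (rule finite_imp_bounded)
qed

lemma reduced_solution_lift:
  assumes graph: "regular_graph k V E" "perfect_coloring V E m \<Gamma>"
    and sol: "reduced_solution d k m f J x"
  shows "gde_solution V E d f J (\<lambda>t i. x t $ \<Gamma> i)"
  unfolding gde_solution_def
proof (intro conjI ballI impI)
  fix t assume "t \<in> J"
  show "bounded ((\<lambda>i. x t $ \<Gamma> i) ` V)" by (rule bounded_lift)
  show "uniform_limit V (\<lambda>t i. x t $ \<Gamma> i) (\<lambda>i. x t $ \<Gamma> i) (at t within J)"
    using sol \<open>t \<in> J\<close> by (intro uniform_limit_vec_components) (auto simp: reduced_solution_def continuous_on_def)
  fix i assume "0 < t" "i \<in> V"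
  then have "(x has_vector_derivative reduced_rhs d k m f (x t)) (at t)"
    using sol \<open>t \<in> J\<close> by (simp add: reduced_solution_def)
  then show "((\<lambda>s. x s $ \<Gamma> i) has_real_derivative gde_rhs V E d f (\<lambda>i. x t $ \<Gamma> i) i) (at t)"
    using gde_rhs_lift[OF graph \<open>i \<in> V\<close>] by (simp add: has_real_derivative_component)
qed

lemma gde_solution_subset:
  assumes "gde_solution V E d f J u" "J' \<subseteq> J"
  shows "gde_solution V E d f J' u"
  using assms unfolding gde_solution_def
  by (meson at_le filterlim_mono order_refl subset_iff)

text \<open>
  Here \<open>u\<close> need not be constant on colour classes. Where a vertex value \<open>u\<^sub>i\<close> nearly touches the
  supersolution, all neighbours are below it, so the diffusion at \<open>i\<close> is at most that of the
  supersolution up to \<open>d k \<rho>\<close>, and the reaction terms differ little because \<open>f\<close> is uniformly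
  continuous on bounded intervals. Each error is at most half the margin with the same \<open>\<rho>\<close> for
  all vertices.
\<close>

lemma gde_solution_below_strict_supersolution:
  assumes "0 < d" and f: "continuous_on UNIV f"
    and graph: "regular_graph k V E" "perfect_coloring V E m \<Gamma>"
    and super: "strict_supersolution (\<lambda>x. reduced_rhs d k m f (box_clamp r v x)) a y"
    and sol: "gde_solution V E d f {0..<T} u"
    and near: "\<forall>t\<in>{0..<T}. \<forall>i\<in>V. \<bar>u t i - v $ \<Gamma> i\<bar> \<le> r"
    and init: "\<forall>i\<in>V. u 0 i \<le> a $ \<Gamma> i"
  shows "\<forall>t\<in>{0..<T}. \<forall>i\<in>V. u t i \<le> y t $ \<Gamma> i"
proof -
  obtain \<eta> where cont_y: "continuous_on {0..} y" and "0 < \<eta>"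
    and y_0: "\<And>c. a $ c + \<eta> \<le> y 0 $ c"
    and der_y: "\<And>t. 0 < t \<Longrightarrow> \<exists>D. (y has_vector_derivative D) (at t) \<and>
      (\<forall>c. reduced_rhs d k m f (box_clamp r v (y t)) $ c + \<eta> \<le> D $ c)"
    using super unfolding strict_supersolution_def by blast
  define I where "I = {- (norm v + \<bar>r\<bar>)..norm v + \<bar>r\<bar>}"
  have I: "x \<in> I" if "\<bar>x - v $ c\<bar> \<le> r" for x c
    using that component_le_norm_cart[of v c] by (auto simp: I_def abs_le_iff)
  have "uniformly_continuous_on I f"
    by (rule compact_uniformly_continuous) (auto simp: I_def intro: continuous_on_subset[OF f])
  then obtain \<rho>1 where "0 < \<rho>1"
    and \<rho>1: "\<And>x x'. x \<in> I \<Longrightarrow> x' \<in> I \<Longrightarrow> \<bar>x' - x\<bar> < \<rho>1 \<Longrightarrow> \<bar>f x' - f x\<bar> < \<eta> / 2"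
    using \<open>0 < \<eta>\<close> unfolding uniformly_continuous_on_def dist_real_def by (metis half_gt_zero)
  define \<rho> where "\<rho> = min (min \<rho>1 \<eta>) (\<eta> / (2 * (d * real k + 1)))"
  have dk: "0 \<le> d * real k" using \<open>0 < d\<close> by simp
  then have "0 < \<rho>" using \<open>0 < \<rho>1\<close> \<open>0 < \<eta>\<close> by (simp add: \<rho>_def)
  have "d * real k * \<rho> \<le> d * real k * (\<eta> / (2 * (d * real k + 1)))"
    using dk by (intro mult_left_mono) (auto simp: \<rho>_def)
  also have "\<dots> \<le> \<eta> / 2" using dk \<open>0 < \<eta>\<close> by (simp add: field_simps)
  finally have dk_\<rho>: "d * real k * \<rho> \<le> \<eta> / 2" .
  have "\<forall>t\<in>{0..<T}. \<forall>i\<in>V. \<rho> \<le> y t $ \<Gamma> i - u t i"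
  proof (rule strict_comparison[OF _ _ \<open>0 < \<rho>\<close>])
    fix t assume t: "t \<in> {0..<T}"
    then have "(y \<longlongrightarrow> y t) (at t within {0..<T})"
      using cont_y by (auto simp: continuous_on_def intro: tendsto_within_subset)
    then show "uniform_limit V (\<lambda>t i. y t $ \<Gamma> i - u t i) (\<lambda>i. y t $ \<Gamma> i - u t i) (at t within {0..<T})"
      using sol t by (intro uniform_limit_minus uniform_limit_vec_components) (auto simp: gde_solution_def)
  next
    fix i assume "i \<in> V"
    then show "\<rho> \<le> y 0 $ \<Gamma> i - u 0 i"
      using init[rule_format, of i] y_0[of "\<Gamma> i"] by (simp add: \<rho>_def min_def)
  next
    fix t i assume t: "0 < t" "t < T" and i: "i \<in> V"
      and nonneg: "\<forall>j\<in>V. 0 \<le> y t $ \<Gamma> j - u t j" and less: "y t $ \<Gamma> i - u t i < \<rho>"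
    \<comment> \<open>Clamping does not destroy the ordering, since \<open>u\<close> itself takes its values in the cube.\<close>
    define q where "q = box_clamp r v (y t)"
    have near_t: "\<bar>u t j - v $ \<Gamma> j\<bar> \<le> r" if "j \<in> V" for j using near t that by simp
    have u_le_q: "u t j \<le> q $ \<Gamma> j" if "j \<in> V" for j
      using near_t[OF that] nonneg that by (auto simp: q_def abs_le_iff)
    have q_near: "\<bar>q $ \<Gamma> i - v $ \<Gamma> i\<bar> \<le> r" using near_t[OF i] by (auto simp: q_def abs_le_iff)
    have q_less: "q $ \<Gamma> i - u t i < \<rho>" using near_t[OF i] less \<open>0 < \<rho>\<close> by (auto simp: q_def abs_le_iff)
    have "(\<Sum>j\<in>nbrs V E i. u t j) \<le> (\<Sum>j\<in>nbrs V E i. q $ \<Gamma> j)"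
      by (rule sum_mono) (use u_le_q in \<open>auto simp: nbrs_def\<close>)
    then have sums: "d * (\<Sum>j\<in>nbrs V E i. u t j) \<le> d * (\<Sum>c\<in>UNIV. real (m $ \<Gamma> i $ c) * q $ c)"
      using \<open>0 < d\<close> by (simp add: sum_over_neighbours[OF graph i])
    have "d * real k * (q $ \<Gamma> i - u t i) \<le> d * real k * \<rho>"
      using q_less dk by (intro mult_left_mono) auto
    then have diag: "d * real k * (q $ \<Gamma> i - u t i) \<le> \<eta> / 2" using dk_\<rho> by simp
    have "\<bar>f (q $ \<Gamma> i) - f (u t i)\<bar> < \<eta> / 2"
      using q_less u_le_q[OF i] by (intro \<rho>1 I[OF q_near] I[OF near_t[OF i]]) (auto simp: \<rho>_def)
    then have "f (u t i) - f (q $ \<Gamma> i) < \<eta> / 2" by linarith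
    then have "gde_rhs V E d f (u t) i < reduced_rhs d k m f q $ \<Gamma> i + \<eta>"
      using sums diag by (simp add: gde_rhs_regular[OF graph(1) i] reduced_rhs_component algebra_simps)
    moreover obtain D where D: "(y has_vector_derivative D) (at t)"
      "reduced_rhs d k m f q $ \<Gamma> i + \<eta> \<le> D $ \<Gamma> i"
      using der_y[OF t(1)] by (auto simp: q_def)
    ultimately have "0 < D $ \<Gamma> i - gde_rhs V E d f (u t) i" by simp
    moreover have "((\<lambda>t. y t $ \<Gamma> i - u t i) has_real_derivative D $ \<Gamma> i - gde_rhs V E d f (u t) i) (at t)"
      using sol t i by (intro DERIV_diff has_real_derivative_component D) (auto simp: gde_solution_def)
    ultimately show "\<exists>D>0. ((\<lambda>t. y t $ \<Gamma> i - u t i) has_real_derivative D) (at t)" by blast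
  qed
  then show ?thesis using \<open>0 < \<rho>\<close> by fastforce
qed

section \<open>Stability of the reduced system bounds all nearby graph solutions\<close>

text \<open>
  The truncated system has a solution \<open>w\<close> from \<open>v + \<delta>\<close> that is a limit of strict supersolutions.
  As long as \<open>w\<close> stays where the truncation is invisible it solves the reduced system, so stability
  keeps it closer still; by continuous induction it never gets to the boundary of that region. It is
  thus a global solution, to which attractivity applies. Every graph solution that starts below
  \<open>v + \<delta>\<close> and stays in the region is below the strict supersolutions and hence below \<open>w\<close>.
\<close>

lemma reduced_solution_above_gde_solutions:
  fixes v :: "real ^ 'n" and m :: "nat ^ 'n ^ 'n" and \<Gamma> :: "'v \<Rightarrow> 'n"
  assumes "0 < d" and f: "continuous_on UNIV f"
    and graph: "regular_graph k V E" "perfect_coloring V E m \<Gamma>"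
    and stable: "asymptotically_stable (reduced_solution d k m f) dist v"
    and "0 < \<epsilon>" "\<epsilon> < r"
  shows "\<exists>\<delta>>0. \<exists>w. (\<forall>t\<ge>0. dist (w t) v \<le> \<epsilon>) \<and> (w \<longlongrightarrow> v) at_top \<and>
    (\<forall>T u. gde_solution V E d f {0..<T} u \<longrightarrow>
       (\<forall>t\<in>{0..<T}. \<forall>i\<in>V. \<bar>u t i - v $ \<Gamma> i\<bar> \<le> r) \<longrightarrow>
       (\<forall>i\<in>V. u 0 i \<le> v $ \<Gamma> i + \<delta>) \<longrightarrow>
       (\<forall>t\<in>{0..<T}. \<forall>i\<in>V. u t i \<le> w t $ \<Gamma> i))"
proof -
  define R where "R = reduced_rhs d k m f"
  define H where "H x = R (box_clamp r v x)" for x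
  have "0 \<le> r" using \<open>0 < \<epsilon>\<close> \<open>\<epsilon> < r\<close> by simp
  have cont_R: "continuous_on UNIV R" unfolding R_def using f by (rule continuous_on_reduced_rhs)
  obtain B where B: "\<And>x. norm (H x) \<le> B"
    using clamped_field_regular(2)[OF cont_R \<open>0 \<le> r\<close>, of v] unfolding H_def by blast
  have uc: "uniformly_continuous_on UNIV H"
    unfolding H_def using cont_R \<open>0 \<le> r\<close> by (rule clamped_field_regular(1))
  have qm: "quasimonotone H" unfolding H_def R_def
    using \<open>0 < d\<close> by (intro quasimonotone_box_clamp quasimonotone_reduced_rhs) simp
  obtain \<delta>0 where "0 < \<delta>0" and \<delta>0: "\<And>T x t. \<lbrakk>0 < T; reduced_solution d k m f {0..<T} x;
      dist (x 0) v < \<delta>0; t \<in> {0..<T}\<rbrakk> \<Longrightarrow> dist (x t) v < \<epsilon>"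
    using stable \<open>0 < \<epsilon>\<close> unfolding asymptotically_stable_def by metis
  obtain \<kappa> where "0 < \<kappa>" and \<kappa>: "\<And>x. \<lbrakk>reduced_solution d k m f {0..} x; dist (x 0) v < \<kappa>\<rbrakk>
      \<Longrightarrow> ((\<lambda>t. dist (x t) v) \<longlongrightarrow> 0) at_top"
    using stable unfolding asymptotically_stable_def by metis
  \<comment> \<open>The offset \<open>\<delta>\<close> in every coordinate moves \<open>v\<close> by a distance less than \<open>e\<close>.\<close>
  define e where "e = min \<epsilon> (min \<delta>0 \<kappa>)"
  define \<delta> where "\<delta> = e / (2 * real CARD('n))"
  have "0 < e" using \<open>0 < \<epsilon>\<close> \<open>0 < \<delta>0\<close> \<open>0 < \<kappa>\<close> by (simp add: e_def)
  then have "0 < \<delta>" by (simp add: \<delta>_def)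
  have "dist (v + vec \<delta>) v \<le> (\<Sum>c\<in>(UNIV :: 'n set). \<bar>\<delta>\<bar>)"
    using norm_le_l1_cart[of "vec \<delta> :: real ^ 'n"] by (simp add: dist_norm)
  also have "\<dots> = e / 2" using \<open>0 < e\<close> by (simp add: \<delta>_def)
  also have "\<dots> < e" using \<open>0 < e\<close> by simp
  finally have init: "dist (v + vec \<delta>) v < e" .
  obtain y w where super: "\<And>n. strict_supersolution H (v + vec \<delta>) (y n)"
    and lim: "\<And>t. 0 \<le> t \<Longrightarrow> (\<lambda>n. y n t) \<longlonglongrightarrow> w t"
    and cont_w: "continuous_on {0..} w" and w_0: "w 0 = v + vec \<delta>"
    and der_w: "\<And>t. 0 < t \<Longrightarrow> (w has_vector_derivative H (w t)) (at t)"
    using solution_as_limit_of_strict_supersolutions[OF qm uc B, of "v + vec \<delta>"] by blast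
  have w_solution: "reduced_solution d k m f J w" if "J \<subseteq> {0..}" "\<forall>t\<in>J. dist (w t) v \<le> r" for J
    unfolding reduced_solution_def
  proof (intro conjI ballI impI)
    show "continuous_on J w" using cont_w that(1) by (rule continuous_on_subset)
    fix t assume "t \<in> J" "0 < t"
    then show "(w has_vector_derivative reduced_rhs d k m f (w t)) (at t)"
      using der_w[of t] that by (simp add: H_def R_def box_clamp_id)
  qed
  have w_near: "dist (w t) v \<le> \<epsilon>" if "0 \<le> t" for t
  proof -
    \<comment> \<open>Continuous induction for a single curve, which is indexed by the unit type.\<close>
    have "\<forall>s\<in>{0..<t + 1}. \<forall>i\<in>{()}. - \<epsilon> \<le> - dist (w s) v"
    proof (rule barrier_bootstrap)
      show "- r < - \<epsilon>" using \<open>\<epsilon> < r\<close> by simp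
      show "- \<epsilon> \<le> - dist (w 0) v" using init by (simp add: w_0 e_def)
      fix s assume "s \<in> {0..<t + 1}"
      then have "(w \<longlongrightarrow> w s) (at s within {0..<t + 1})"
        using cont_w by (auto simp: continuous_on_def intro: tendsto_within_subset)
      then have "((\<lambda>s. - dist (w s) v) \<longlongrightarrow> - dist (w s) v) (at s within {0..<t + 1})"
        by (intro tendsto_intros)
      then show "uniform_limit {()} (\<lambda>s i. - dist (w s) v) (\<lambda>i. - dist (w s) v) (at s within {0..<t + 1})"
        by (simp add: uniform_limit_iff tendsto_iff)
    next
      fix S assume "0 < S" and "\<forall>s\<in>{0..<S}. \<forall>i\<in>{()}. - r \<le> - dist (w s) v"
      then have "reduced_solution d k m f {0..<S} w" by (intro w_solution) auto
      then have "dist (w s) v < \<epsilon>" if "s \<in> {0..<S}" for s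
        using \<delta>0[OF \<open>0 < S\<close> _ _ that] init by (simp add: w_0 e_def)
      then show "\<forall>s\<in>{0..<S}. \<forall>i\<in>{()}. - \<epsilon> \<le> - dist (w s) v" by force
    qed
    then show ?thesis using that by simp
  qed
  have "reduced_solution d k m f {0..} w"
    using w_near \<open>\<epsilon> < r\<close> by (intro w_solution) (auto intro: order_trans less_imp_le)
  then have "((\<lambda>t. dist (w t) v) \<longlongrightarrow> 0) at_top" using init by (intro \<kappa>) (auto simp: w_0 e_def)
  then have w_lim: "(w \<longlongrightarrow> v) at_top" by (rule tendsto_dist_iff[THEN iffD2])
  have below: "u t i \<le> w t $ \<Gamma> i" if "gde_solution V E d f {0..<T} u"
    "\<forall>t\<in>{0..<T}. \<forall>i\<in>V. \<bar>u t i - v $ \<Gamma> i\<bar> \<le> r" "\<forall>i\<in>V. u 0 i \<le> v $ \<Gamma> i + \<delta>"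
    "t \<in> {0..<T}" "i \<in> V" for T u t i
  proof (rule LIMSEQ_le_const)
    show "(\<lambda>n. y n t $ \<Gamma> i) \<longlonglongrightarrow> w t $ \<Gamma> i" using lim that(4) by (intro tendsto_vec_nth) simp
    have "\<forall>i\<in>V. u 0 i \<le> (v + vec \<delta>) $ \<Gamma> i" using that(3) by simp
    then show "\<exists>N. \<forall>n\<ge>N. u t i \<le> y n t $ \<Gamma> i"
      using gde_solution_below_strict_supersolution[OF \<open>0 < d\<close> f graph
          super[unfolded H_def R_def] that(1,2)] that(4,5) by blast
  qed
  show ?thesis
  proof (rule exI[of _ \<delta>], rule conjI[OF \<open>0 < \<delta>\<close>], rule exI[of _ w], intro conjI allI impI ballI)
    show "dist (w t) v \<le> \<epsilon>" if "0 \<le> t" for t using that by (rule w_near)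
    show "(w \<longlongrightarrow> v) at_top" by (rule w_lim)
  qed (rule below)
qed

text \<open>
  The substitution \<open>u \<mapsto> - u\<close> turns both systems into systems of the same kind with the odd reflection
  of \<open>f\<close>; it exchanges upper and lower bounds.
\<close>

lemma reduced_rhs_reflect: "reduced_rhs d k m (\<lambda>x. - f (- x)) x = - reduced_rhs d k m f (- x)"
  by (simp add: vec_eq_iff reduced_rhs_component sum_negf algebra_simps)

lemma reduced_solution_reflect:
  assumes "reduced_solution d k m (\<lambda>x. - f (- x)) J x"
  shows "reduced_solution d k m f J (\<lambda>t. - x t)"
  unfolding reduced_solution_def
proof (intro conjI ballI impI)
  show "continuous_on J (\<lambda>t. - x t)"
    using assms by (intro continuous_on_minus) (simp add: reduced_solution_def)
  fix t assume "t \<in> J" "0 < t"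
  then have "(x has_vector_derivative - reduced_rhs d k m f (- x t)) (at t)"
    using assms by (simp add: reduced_solution_def reduced_rhs_reflect)
  from has_vector_derivative_minus[OF this]
  show "((\<lambda>t. - x t) has_vector_derivative reduced_rhs d k m f (- x t)) (at t)" by simp
qed

lemma gde_solution_reflect:
  assumes "gde_solution V E d f J u"
  shows "gde_solution V E d (\<lambda>x. - f (- x)) J (\<lambda>t i. - u t i)"
proof -
  have rhs: "gde_rhs V E d (\<lambda>x. - f (- x)) (\<lambda>i. - u t i) i = - gde_rhs V E d f (u t) i" for t i
    by (simp add: gde_rhs_def sum_subtractf sum_negf algebra_simps)
  show ?thesis unfolding gde_solution_def rhs
  proof (intro conjI ballI impI)
    fix t assume t: "t \<in> J"
    then have "bounded (uminus ` (u t ` V))" using assms by (simp add: gde_solution_def)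
    then show "bounded ((\<lambda>i. - u t i) ` V)" by (simp add: image_image)
    show "uniform_limit V (\<lambda>t i. - u t i) (\<lambda>i. - u t i) (at t within J)"
      using assms t by (intro uniform_limit_intros) (simp add: gde_solution_def)
    fix i assume "0 < t" "i \<in> V"
    then show "((\<lambda>t. - u t i) has_real_derivative - gde_rhs V E d f (u t) i) (at t)"
      using assms t by (intro DERIV_minus) (simp add: gde_solution_def)
  qed
qed

text \<open>
  Stability passes to a subsystem that is embedded by a map \<open>\<phi>\<close> which sends solutions to solutions
  and distorts the distance to the equilibrium by a bounded factor. It serves both for the
  reflection and for the lift of colour vectors to vertex states.
\<close>

lemma asymptotically_stable_pullback:
  assumes stable: "asymptotically_stable sol dst (\<phi> y0)"
    and stationary: "sol' {0..} (\<lambda>_. y0)"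
    and sol: "\<And>J y. sol' J y \<Longrightarrow> sol J (\<lambda>t. \<phi> (y t))"
    and "0 < C" and le: "\<And>y. dst (\<phi> y) (\<phi> y0) \<le> C * dst' y y0"
    and ge: "\<And>y. dst' y y0 \<le> C * dst (\<phi> y) (\<phi> y0)" and nonneg: "\<And>y. 0 \<le> dst' y y0"
  shows "asymptotically_stable sol' dst' y0"
  unfolding asymptotically_stable_def
proof (intro conjI allI impI)
  have close: "dst (\<phi> y) (\<phi> y0) < e" if "dst' y y0 < e / C" for y e
    using le[of y] that \<open>0 < C\<close> by (simp add: field_simps)
  fix \<epsilon> :: real assume "0 < \<epsilon>"
  then have "0 < \<epsilon> / C" using \<open>0 < C\<close> by simp
  then obtain \<delta> where "0 < \<delta>" and \<delta>: "\<And>T x t. \<lbrakk>0 < T; sol {0..<T} x; dst (x 0) (\<phi> y0) < \<delta>; t \<in> {0..<T}\<rbrakk>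
      \<Longrightarrow> dst (x t) (\<phi> y0) < \<epsilon> / C"
    using stable unfolding asymptotically_stable_def by metis
  have "dst' (y t) y0 < \<epsilon>" if "0 < T" "sol' {0..<T} y" "dst' (y 0) y0 < \<delta> / C" "t \<in> {0..<T}" for T y t
  proof -
    have "dst (\<phi> (y t)) (\<phi> y0) < \<epsilon> / C"
      using \<delta>[OF that(1) sol[OF that(2)] _ that(4)] close[OF that(3)] by simp
    then show ?thesis using ge[of "y t"] \<open>0 < C\<close> by (simp add: field_simps)
  qed
  then show "\<exists>\<delta>>0. \<forall>T>0. \<forall>y. sol' {0..<T} y \<longrightarrow> dst' (y 0) y0 < \<delta> \<longrightarrow> (\<forall>t\<in>{0..<T}. dst' (y t) y0 < \<epsilon>)"
    using \<open>0 < \<delta>\<close> \<open>0 < C\<close> by (intro exI[of _ "\<delta> / C"]) simp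
next
  obtain \<kappa> where "0 < \<kappa>" and \<kappa>: "\<And>x. \<lbrakk>sol {0..} x; dst (x 0) (\<phi> y0) < \<kappa>\<rbrakk>
      \<Longrightarrow> ((\<lambda>t. dst (x t) (\<phi> y0)) \<longlongrightarrow> 0) at_top"
    using stable unfolding asymptotically_stable_def by metis
  have "((\<lambda>t. dst' (y t) y0) \<longlongrightarrow> 0) at_top" if "sol' {0..} y" "dst' (y 0) y0 < \<kappa> / C" for y
  proof -
    have "dst (\<phi> (y 0)) (\<phi> y0) < \<kappa>" using le[of "y 0"] that(2) \<open>0 < C\<close> by (simp add: field_simps)
    then have "((\<lambda>t. dst (\<phi> (y t)) (\<phi> y0)) \<longlongrightarrow> 0) at_top" by (rule \<kappa>[OF sol[OF that(1)]])
    then have upper: "((\<lambda>t. C * dst (\<phi> (y t)) (\<phi> y0)) \<longlongrightarrow> 0) at_top" by (rule tendsto_mult_right_zero)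
    show ?thesis by (rule tendsto_sandwich[OF _ _ tendsto_const upper]) (use ge nonneg in auto)
  qed
  then show "\<exists>\<eta>>0. \<forall>y. sol' {0..} y \<longrightarrow> dst' (y 0) y0 < \<eta> \<longrightarrow> ((\<lambda>t. dst' (y t) y0) \<longlongrightarrow> 0) at_top"
    using \<open>0 < \<kappa>\<close> \<open>0 < C\<close> by (intro exI[of _ "\<kappa> / C"]) simp
qed (rule stationary)

lemma linf_dist_le:
  assumes "V \<noteq> {}" "\<And>i. i \<in> V \<Longrightarrow> \<bar>u i - w i\<bar> \<le> e"
  shows "linf_dist V u w \<le> e"
  unfolding linf_dist_def using assms by (rule cSUP_least)

lemma le_linf_dist:
  assumes "bounded (u ` V)" "bounded (w ` V)" "i \<in> V"
  shows "\<bar>u i - w i\<bar> \<le> linf_dist V u w"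
  unfolding linf_dist_def
proof (rule cSUP_upper[OF \<open>i \<in> V\<close>])
  obtain a b where "\<forall>i\<in>V. \<bar>u i\<bar> \<le> a" "\<forall>i\<in>V. \<bar>w i\<bar> \<le> b"
    using assms by (auto simp: bounded_iff)
  then show "bdd_above ((\<lambda>i. \<bar>u i - w i\<bar>) ` V)"
    by (intro bdd_aboveI2[of _ _ "a + b"]) fastforce
qed

text \<open>
  The upper bound needs the graph solution to stay in the region where the truncation is
  invisible, and only both bounds together confine it there. Continuous induction breaks the circle:
  being within \<open>2 \<epsilon>\<close> up to some time gives both bounds and with them the distance \<open>\<epsilon>\<close> up to
  that time.
\<close>

lemma gde_solutions_between_reduced_solutions:
  fixes v :: "real ^ 'n" and m :: "nat ^ 'n ^ 'n" and \<Gamma> :: "'v \<Rightarrow> 'n"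
  assumes "0 < d" and f: "continuous_on UNIV f"
    and graph: "regular_graph k V E" "perfect_coloring V E m \<Gamma>"
    and stable: "asymptotically_stable (reduced_solution d k m f) dist v"
    and "0 < \<epsilon>"
  shows "\<exists>\<delta>>0. \<exists>l w. (l \<longlongrightarrow> v) at_top \<and> (w \<longlongrightarrow> v) at_top \<and>
    (\<forall>T u. gde_solution V E d f {0..<T} u \<longrightarrow> (\<forall>i\<in>V. \<bar>u 0 i - v $ \<Gamma> i\<bar> \<le> \<delta>) \<longrightarrow>
       (\<forall>t\<in>{0..<T}. \<forall>i\<in>V. \<bar>u t i - v $ \<Gamma> i\<bar> \<le> \<epsilon> \<and> l t $ \<Gamma> i \<le> u t i \<and> u t i \<le> w t $ \<Gamma> i))"
proof -
  let ?g = "\<lambda>x. - f (- x)"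
  have "reduced_solution d k m f {0..} (\<lambda>_. v)"
    using stable by (simp add: asymptotically_stable_def)
  then have "reduced_solution d k m ?g {0..} (\<lambda>_. - v)"
    using reduced_solution_reflect[of d k m ?g "{0..}" "\<lambda>_. v"] by simp
  have "asymptotically_stable (reduced_solution d k m f) dist (- (- v))" using stable by simp
  then have stable': "asymptotically_stable (reduced_solution d k m ?g) dist (- v)"
  proof (rule asymptotically_stable_pullback)
    show "reduced_solution d k m ?g {0..} (\<lambda>_. - v)" by fact
    show "reduced_solution d k m f J (\<lambda>t. - y t)" if "reduced_solution d k m ?g J y" for J y
      using that by (rule reduced_solution_reflect)
    show "dist (- y) (- (- v)) \<le> 1 * dist y (- v)" "dist y (- v) \<le> 1 * dist (- y) (- (- v))" for y
      by (simp_all only: dist_minus mult_1)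
  qed simp_all
  have g: "continuous_on UNIV ?g"
    by (intro continuous_intros continuous_on_compose2[OF f]) auto
  have "\<epsilon> < 2 * \<epsilon>" using \<open>0 < \<epsilon>\<close> by simp
  obtain \<delta>1 w where "0 < \<delta>1" and w: "\<And>t. 0 \<le> t \<Longrightarrow> dist (w t) v \<le> \<epsilon>" "(w \<longlongrightarrow> v) at_top"
    and upper: "\<And>T u t i. \<lbrakk>gde_solution V E d f {0..<T} u; \<forall>t\<in>{0..<T}. \<forall>i\<in>V. \<bar>u t i - v $ \<Gamma> i\<bar> \<le> 2 * \<epsilon>;
      \<forall>i\<in>V. u 0 i \<le> v $ \<Gamma> i + \<delta>1; t \<in> {0..<T}; i \<in> V\<rbrakk> \<Longrightarrow> u t i \<le> w t $ \<Gamma> i"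
    using reduced_solution_above_gde_solutions[OF \<open>0 < d\<close> f graph stable \<open>0 < \<epsilon>\<close> \<open>\<epsilon> < 2 * \<epsilon>\<close>] by metis
  obtain \<delta>2 l where "0 < \<delta>2" and l: "\<And>t. 0 \<le> t \<Longrightarrow> dist (l t) (- v) \<le> \<epsilon>" "(l \<longlongrightarrow> - v) at_top"
    and lower: "\<And>T u t i. \<lbrakk>gde_solution V E d ?g {0..<T} u; \<forall>t\<in>{0..<T}. \<forall>i\<in>V. \<bar>u t i - (- v) $ \<Gamma> i\<bar> \<le> 2 * \<epsilon>;
      \<forall>i\<in>V. u 0 i \<le> (- v) $ \<Gamma> i + \<delta>2; t \<in> {0..<T}; i \<in> V\<rbrakk> \<Longrightarrow> u t i \<le> l t $ \<Gamma> i"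
    using reduced_solution_above_gde_solutions[OF \<open>0 < d\<close> g graph stable' \<open>0 < \<epsilon>\<close> \<open>\<epsilon> < 2 * \<epsilon>\<close>] by metis
  define \<delta> where "\<delta> = min \<epsilon> (min \<delta>1 \<delta>2)"
  have "0 < \<delta>" using \<open>0 < \<epsilon>\<close> \<open>0 < \<delta>1\<close> \<open>0 < \<delta>2\<close> by (simp add: \<delta>_def)
  have comp: "\<bar>x $ c - z $ c\<bar> \<le> dist x z" for x z :: "real ^ 'n" and c
    using dist_vec_nth_le[of x c z] by (simp add: dist_real_def)
  have "\<bar>u t i - v $ \<Gamma> i\<bar> \<le> \<epsilon> \<and> - l t $ \<Gamma> i \<le> u t i \<and> u t i \<le> w t $ \<Gamma> i"
    if sol: "gde_solution V E d f {0..<T} u" and init: "\<forall>i\<in>V. \<bar>u 0 i - v $ \<Gamma> i\<bar> \<le> \<delta>"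
      and t: "t \<in> {0..<T}" and i: "i \<in> V" for T u t i
  proof -
    have between: "- l t $ \<Gamma> i \<le> u t i \<and> u t i \<le> w t $ \<Gamma> i"
      if S: "S \<le> T" and near: "\<forall>t\<in>{0..<S}. \<forall>i\<in>V. \<bar>u t i - v $ \<Gamma> i\<bar> \<le> 2 * \<epsilon>"
        and t: "t \<in> {0..<S}" and i: "i \<in> V" for S t i
    proof
      have sol_S: "gde_solution V E d f {0..<S} u"
        using sol by (rule gde_solution_subset) (use S in auto)
      show "u t i \<le> w t $ \<Gamma> i"
        by (rule upper[OF sol_S near _ t i]) (use init in \<open>force simp: \<delta>_def abs_le_iff\<close>)
      have "- u t i \<le> l t $ \<Gamma> i"
      proof (rule lower[OF gde_solution_reflect[OF sol_S] _ _ t i])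
        show "\<forall>t\<in>{0..<S}. \<forall>i\<in>V. \<bar>- u t i - (- v) $ \<Gamma> i\<bar> \<le> 2 * \<epsilon>"
          using near by (simp add: abs_minus_commute)
        show "\<forall>i\<in>V. - u 0 i \<le> (- v) $ \<Gamma> i + \<delta>2" using init by (force simp: \<delta>_def abs_le_iff)
      qed
      then show "- l t $ \<Gamma> i \<le> u t i" by simp
    qed
    have "\<forall>t\<in>{0..<T}. \<forall>i\<in>V. - \<epsilon> \<le> - \<bar>u t i - v $ \<Gamma> i\<bar>"
    proof (rule barrier_bootstrap)
      show "- (2 * \<epsilon>) < - \<epsilon>" using \<open>0 < \<epsilon>\<close> by simp
      show "- \<epsilon> \<le> - \<bar>u 0 i - v $ \<Gamma> i\<bar>" if "i \<in> V" for i using init that by (simp add: \<delta>_def)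
      fix t assume "t \<in> {0..<T}"
      then have lim: "uniform_limit V u (u t) (at t within {0..<T})" using sol by (simp add: gde_solution_def)
      show "uniform_limit V (\<lambda>t i. - \<bar>u t i - v $ \<Gamma> i\<bar>) (\<lambda>i. - \<bar>u t i - v $ \<Gamma> i\<bar>) (at t within {0..<T})"
      proof (rule uniform_limitI)
        fix e :: real assume "0 < e"
        with lim have "\<forall>\<^sub>F s in at t within {0..<T}. \<forall>i\<in>V. dist (u s i) (u t i) < e" by (rule uniform_limitD)
        then show "\<forall>\<^sub>F s in at t within {0..<T}. \<forall>i\<in>V.
            dist (- \<bar>u s i - v $ \<Gamma> i\<bar>) (- \<bar>u t i - v $ \<Gamma> i\<bar>) < e"
          by eventually_elim (force simp: dist_real_def)
      qed
    next
      fix S assume S: "S \<le> T" and near: "\<forall>t\<in>{0..<S}. \<forall>i\<in>V. - (2 * \<epsilon>) \<le> - \<bar>u t i - v $ \<Gamma> i\<bar>"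
      show "\<forall>t\<in>{0..<S}. \<forall>i\<in>V. - \<epsilon> \<le> - \<bar>u t i - v $ \<Gamma> i\<bar>"
      proof (intro ballI)
        fix t i assume t: "t \<in> {0..<S}" and i: "i \<in> V"
        have "- l t $ \<Gamma> i \<le> u t i \<and> u t i \<le> w t $ \<Gamma> i"
          using between[OF S _ t i] near by simp
        moreover have "\<bar>w t $ \<Gamma> i - v $ \<Gamma> i\<bar> \<le> \<epsilon>" "\<bar>l t $ \<Gamma> i - (- v) $ \<Gamma> i\<bar> \<le> \<epsilon>"
          by (rule order_trans[OF comp w(1)] order_trans[OF comp l(1)], use t in simp)+
        ultimately show "- \<epsilon> \<le> - \<bar>u t i - v $ \<Gamma> i\<bar>" by (simp add: abs_le_iff)
      qed
    qed
    then have near: "\<forall>t\<in>{0..<T}. \<forall>i\<in>V. \<bar>u t i - v $ \<Gamma> i\<bar> \<le> \<epsilon>" by simp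
    then have "\<forall>t\<in>{0..<T}. \<forall>i\<in>V. \<bar>u t i - v $ \<Gamma> i\<bar> \<le> 2 * \<epsilon>" using \<open>0 < \<epsilon>\<close> by force
    then show ?thesis using near between[OF order_refl _ t i] t i by blast
  qed
  then show ?thesis
    using \<open>0 < \<delta>\<close> w(2) tendsto_minus[OF l(2)]
    by - (rule exI[of _ \<delta>], rule conjI, assumption, rule exI[of _ "\<lambda>t. - l t"], rule exI[of _ w], simp)
qed

section \<open>Equivalence of the two stability notions\<close>

lemma reduced_stable_imp_gde_stable:
  fixes v :: "real ^ 'n" and m :: "nat ^ 'n ^ 'n" and \<Gamma> :: "'v \<Rightarrow> 'n"
  assumes "0 < d" and f: "continuous_on UNIV f"
    and graph: "regular_graph k V E" "perfect_coloring V E m \<Gamma>"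
    and stable: "asymptotically_stable (reduced_solution d k m f) dist v"
  shows "asymptotically_stable (gde_solution V E d f) (linf_dist V) (\<lambda>i. v $ \<Gamma> i)"
  unfolding asymptotically_stable_def
proof (intro conjI allI impI)
  let ?u0 = "\<lambda>i. v $ \<Gamma> i"
  have "V \<noteq> {}" using graph by (simp add: regular_graph_def simple_graph_def)
  show "gde_solution V E d f {0..} (\<lambda>_. ?u0)"
    using reduced_solution_lift[OF graph] stable unfolding asymptotically_stable_def by blast
  have init: "\<forall>i\<in>V. \<bar>u 0 i - v $ \<Gamma> i\<bar> \<le> \<delta>"
    if "gde_solution V E d f J u" "0 \<in> J" "linf_dist V (u 0) ?u0 < \<delta>" for J u \<delta>
  proof
    fix i assume "i \<in> V"
    have "bounded (u 0 ` V)" using that by (simp add: gde_solution_def)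
    from le_linf_dist[OF this bounded_lift \<open>i \<in> V\<close>, of v \<Gamma>] show "\<bar>u 0 i - v $ \<Gamma> i\<bar> \<le> \<delta>"
      using that(3) by simp
  qed
  {
    fix \<epsilon> :: real assume "0 < \<epsilon>"
    then have "0 < \<epsilon> / 2" by simp
    from gde_solutions_between_reduced_solutions[OF \<open>0 < d\<close> f graph stable this] obtain \<delta> where "0 < \<delta>"
      and \<delta>: "\<And>T u t i. \<lbrakk>gde_solution V E d f {0..<T} u; \<forall>i\<in>V. \<bar>u 0 i - v $ \<Gamma> i\<bar> \<le> \<delta>; t \<in> {0..<T}; i \<in> V\<rbrakk>
        \<Longrightarrow> \<bar>u t i - v $ \<Gamma> i\<bar> \<le> \<epsilon> / 2"
      by metis
    have "linf_dist V (u t) ?u0 < \<epsilon>"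
      if "0 < T" "gde_solution V E d f {0..<T} u" "linf_dist V (u 0) ?u0 < \<delta>" "t \<in> {0..<T}" for T u t
    proof -
      have "linf_dist V (u t) ?u0 \<le> \<epsilon> / 2"
        by (rule linf_dist_le[OF \<open>V \<noteq> {}\<close> \<delta>[OF that(2) init[OF that(2) _ that(3)] that(4)]]) (use that in auto)
      then show ?thesis using \<open>0 < \<epsilon>\<close> by simp
    qed
    then show "\<exists>\<delta>>0. \<forall>T>0. \<forall>u. gde_solution V E d f {0..<T} u \<longrightarrow> linf_dist V (u 0) ?u0 < \<delta> \<longrightarrow>
        (\<forall>t\<in>{0..<T}. linf_dist V (u t) ?u0 < \<epsilon>)"
      using \<open>0 < \<delta>\<close> by blast
  }
  from gde_solutions_between_reduced_solutions[OF \<open>0 < d\<close> f graph stable zero_less_one]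
  obtain \<delta> l w where "0 < \<delta>"
    and lim: "(l \<longlongrightarrow> v) at_top" "(w \<longlongrightarrow> v) at_top"
    and between: "\<And>T u t i. \<lbrakk>gde_solution V E d f {0..<T} u; \<forall>i\<in>V. \<bar>u 0 i - v $ \<Gamma> i\<bar> \<le> \<delta>; t \<in> {0..<T}; i \<in> V\<rbrakk>
      \<Longrightarrow> l t $ \<Gamma> i \<le> u t i \<and> u t i \<le> w t $ \<Gamma> i"
    by metis
  have "((\<lambda>t. linf_dist V (u t) ?u0) \<longlongrightarrow> 0) at_top"
    if sol: "gde_solution V E d f {0..} u" and start: "linf_dist V (u 0) ?u0 < \<delta>" for u
  proof (rule tendsto_sandwich[OF _ _ tendsto_const])
    have near: "\<bar>u t i - v $ \<Gamma> i\<bar> \<le> dist (l t) v + dist (w t) v" if "0 \<le> t" "i \<in> V" for t i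
    proof -
      have "gde_solution V E d f {0..<t + 1} u" using sol by (rule gde_solution_subset) auto
      then have "l t $ \<Gamma> i \<le> u t i \<and> u t i \<le> w t $ \<Gamma> i"
        by (rule between) (use init[OF sol _ start] that in auto)
      then show ?thesis
        using dist_vec_nth_le[of "l t" "\<Gamma> i" v] dist_vec_nth_le[of "w t" "\<Gamma> i" v]
        by (auto simp: dist_real_def abs_le_iff)
    qed
    show "\<forall>\<^sub>F t in at_top. linf_dist V (u t) ?u0 \<le> dist (l t) v + dist (w t) v"
      using eventually_ge_at_top[of 0]
      by eventually_elim (intro linf_dist_le[OF \<open>V \<noteq> {}\<close>] near)
    have "((\<lambda>t. dist (l t) v + dist (w t) v) \<longlongrightarrow> 0 + 0) at_top"
      using lim by (intro tendsto_add) (simp_all add: tendsto_dist_iff[symmetric])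
    then show "((\<lambda>t. dist (l t) v + dist (w t) v) \<longlongrightarrow> 0) at_top" by simp
    obtain i where "i \<in> V" using \<open>V \<noteq> {}\<close> by blast
    show "\<forall>\<^sub>F t in at_top. 0 \<le> linf_dist V (u t) ?u0"
      using eventually_ge_at_top[of 0]
    proof eventually_elim
      case (elim t)
      then have "bounded (u t ` V)" using sol by (simp add: gde_solution_def)
      from le_linf_dist[OF this bounded_lift \<open>i \<in> V\<close>] show ?case by (rule order_trans[OF abs_ge_zero])
    qed
  qed
  then show "\<exists>\<eta>>0. \<forall>u. gde_solution V E d f {0..} u \<longrightarrow> linf_dist V (u 0) ?u0 < \<eta> \<longrightarrow>
      ((\<lambda>t. linf_dist V (u t) ?u0) \<longlongrightarrow> 0) at_top"
    using \<open>0 < \<delta>\<close> by blast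
qed

text \<open>
  If a colour were not used, the graph would carry no information on the corresponding component
  of \<open>v\<close>; surjectivity of \<open>\<Gamma>\<close> makes the supremum norm of the lifted state equivalent to the norm of
  the colour vector.
\<close>

lemma gde_stable_imp_reduced_stable:
  fixes v :: "real ^ 'n" and m :: "nat ^ 'n ^ 'n" and \<Gamma> :: "'v \<Rightarrow> 'n"
  assumes graph: "regular_graph k V E" "perfect_coloring V E m \<Gamma>"
    and surj: "\<Gamma> ` V = UNIV"
    and stationary: "reduced_rhs d k m f v = 0"
    and stable: "asymptotically_stable (gde_solution V E d f) (linf_dist V) (\<lambda>i. v $ \<Gamma> i)"
  shows "asymptotically_stable (reduced_solution d k m f) dist v"
proof (rule asymptotically_stable_pullback[where \<phi> = "\<lambda>x i. x $ \<Gamma> i" and C = "real CARD('n)", OF stable])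
  have "V \<noteq> {}" using graph by (simp add: regular_graph_def simple_graph_def)
  show "reduced_solution d k m f {0..} (\<lambda>_. v)"
    by (simp add: reduced_solution_def stationary)
  show "0 < real CARD('n)" by simp
  fix x :: "real ^ 'n"
  have "linf_dist V (\<lambda>i. x $ \<Gamma> i) (\<lambda>i. v $ \<Gamma> i) \<le> dist x v"
    using dist_vec_nth_le[of x _ v] by (intro linf_dist_le \<open>V \<noteq> {}\<close>) (simp add: dist_real_def)
  also have "\<dots> \<le> real CARD('n) * dist x v"
    using mult_right_mono[of 1 "real CARD('n)" "dist x v"] by (simp add: Suc_le_eq)
  finally show "linf_dist V (\<lambda>i. x $ \<Gamma> i) (\<lambda>i. v $ \<Gamma> i) \<le> real CARD('n) * dist x v" .
  have comp: "\<bar>(x - v) $ c\<bar> \<le> linf_dist V (\<lambda>i. x $ \<Gamma> i) (\<lambda>i. v $ \<Gamma> i)" for c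
  proof -
    obtain i where "i \<in> V" "c = \<Gamma> i" using surj by blast
    then show ?thesis using le_linf_dist[OF bounded_lift bounded_lift, of i V x \<Gamma> v \<Gamma>] by simp
  qed
  have "dist x v \<le> (\<Sum>c\<in>UNIV. \<bar>(x - v) $ c\<bar>)" unfolding dist_norm by (rule norm_le_l1_cart)
  also have "\<dots> \<le> real CARD('n) * linf_dist V (\<lambda>i. x $ \<Gamma> i) (\<lambda>i. v $ \<Gamma> i)"
    by (rule sum_bounded_above) (rule comp)
  finally show "dist x v \<le> real CARD('n) * linf_dist V (\<lambda>i. x $ \<Gamma> i) (\<lambda>i. v $ \<Gamma> i)" .
qed (simp_all add: reduced_solution_lift[OF graph])

theorem theorem3p2:
  fixes V :: "'v set" and E :: "'v set set" and k :: nat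
    and m :: "nat ^ 'n ^ 'n" and d :: real and f :: "real \<Rightarrow> real"
    and v :: "real ^ 'n" and \<Gamma> :: "'v \<Rightarrow> 'n"
  assumes "k \<ge> 1" and "d > 0" and "continuous_on UNIV f"
    and "regular_graph k V E"
    and "\<forall>i. (\<Sum>j\<in>UNIV. m $ i $ j) = k"
    and "0 = reduced_rhs d k m f v"
    and "perfect_coloring V E m \<Gamma>"
  shows "\<exists>u :: 'v \<Rightarrow> real. (\<forall>i\<in>V. v $ \<Gamma> i = u i) \<and>
           perfect_stationary V E d f m u \<and>
           (\<Gamma> ` V = UNIV \<longrightarrow>
             (asymptotically_stable (reduced_solution d k m f) dist v \<longleftrightarrow>
              asymptotically_stable (gde_solution V E d f) (linf_dist V) u))"
proof (intro exI[of _ "\<lambda>i. v $ \<Gamma> i"] conjI impI)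
  note graph = \<open>regular_graph k V E\<close> \<open>perfect_coloring V E m \<Gamma>\<close>
  have stationary: "reduced_rhs d k m f v = 0" using assms(6) by simp
  obtain i0 where "i0 \<in> V" using graph(1) by (auto simp: regular_graph_def simple_graph_def)
  \<comment> \<open>Unused colours get a value that occurs, so that the colour values exhaust exactly the image.\<close>
  define w where "w c = (if c \<in> \<Gamma> ` V then v $ c else v $ \<Gamma> i0)" for c
  show "perfect_stationary V E d f m (\<lambda>i. v $ \<Gamma> i)"
    unfolding perfect_stationary_def
  proof (intro conjI exI[of _ \<Gamma>] exI[of _ w])
    show "gde_stationary V E d f (\<lambda>i. v $ \<Gamma> i)"
      using gde_rhs_lift[OF graph] by (simp add: gde_stationary_def stationary)
    show "range w = (\<lambda>i. v $ \<Gamma> i) ` V" using \<open>i0 \<in> V\<close> by (force simp: w_def)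
  qed (use graph in \<open>auto simp: w_def\<close>)
  assume "\<Gamma> ` V = UNIV"
  then show "asymptotically_stable (reduced_solution d k m f) dist v \<longleftrightarrow>
      asymptotically_stable (gde_solution V E d f) (linf_dist V) (\<lambda>i. v $ \<Gamma> i)"
    using reduced_stable_imp_gde_stable[OF \<open>d > 0\<close> assms(3) graph]
      gde_stable_imp_reduced_stable[OF graph _ stationary] by blast
qed simp

end
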